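(* Let $\lambda=(\lambda_1,\ldots,\lambda_n)$ be a partition for which the multivariable Bessel polynomial $Y_\lambda$ is well-defined. Then $Y_\lambda$ has the series expansion $$Y_\lambda = P_\lambda + \sum_{\mu\subset\lambda} u_{\lambda\mu}P_\mu$$ in Jack polynomials, with coefficients $$u_{\lambda\mu} = 2^{|\lambda|-|\mu|}\sum_T \prod_{i=1}^{|\lambda|-|\mu|}\frac{P_{{}^{(i-1)}\lambda}(1^n)}{P_{{}^{(i)}\lambda}(1^n)}\binom{{}^{(i-1)}\lambda}{{}^{(i)}\lambda}\,\frac{1}{ai + d_\lambda - d_{{}^{(i)}\lambda}},$$ where the sum is over all standard tableaux $T$ of shape $\lambda/\mu$, i.e. over all chains of partitions $T:\ \lambda={}^{(0)}\lambda\supset{}^{(1)}\lambda\supset\cdots\supset{}^{(r)}\lambda=\mu$ with $r=|\lambda|-|\mu|$ and $|{}^{(i-1)}\lambda|-|{}^{(i)}\lambda|=1$ for all $i=1,\ldots,r$.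
   Context: Let $n\ge 1$ and let $a,\kappa$ be real parameters; $x=(x_1,\ldots,x_n)$ and $1^n=(1,\ldots,1)$. Partitions are integer sequences $\lambda=(\lambda_1\ge\cdots\ge\lambda_n\ge 0)$, $|\lambda|=\sum_i\lambda_i$; $\mu\subseteq\lambda$ means $\mu_i\le\lambda_i$ for all $i$, and $\mu\subset\lambda$ means $\mu\subseteq\lambda$, $\mu\ne\lambda$. Dominance order: $\mu\le\lambda$ iff $|\mu|=|\lambda|$ and $\mu_1+\cdots+\mu_i\le\lambda_1+\cdots+\lambda_i$ for all $i$. $m_\lambda=\sum_{\alpha\in S_n\lambda}x^\alpha$ is the monomial symmetric polynomial. Jack polynomials: $P_\lambda=P_\lambda(x;\kappa)$ is the unique symmetric polynomial of the form $P_\lambda=m_\lambda+\sum_{\mu<\lambda}c_{\lambda\mu}m_\mu$ that is an eigenfunction of $E_1=\sum_i x_i\partial_{x_i}$ and of $$D_2=\sum_{i}x_i^2\frac{\partial^2}{\partial x_i^2}+2\kappa\sum_{i\ne j}\frac{x_i^2}{x_i-x_j}\frac{\partial}{\partial x_i};$$ one has $D_2P_\lambda=d_\lambda P_\lambda$ with $d_\lambda=\sum_{i=1}^n\lambda_i(\lambda_i-1+2\kappa(n-i))$. The generalised binomial coefficients $\binom{\lambda}{\mu}$ are defined by $$\frac{P_\lambda(x_1+1,\ldots,x_n+1)}{P_\lambda(1^n)}=\sum_{\mu\subseteq\lambda}\binom{\lambda}{\mu}\frac{P_\mu(x_1,\ldots,x_n)}{P_\mu(1^n)}.$$ Bessel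 polynomials: let $$D^B=\sum_{i}x_i^2\frac{\partial^2}{\partial x_i^2}+\sum_i(ax_i+2)\frac{\partial}{\partial x_i}+2\kappa\sum_{i\ne j}\frac{x_i^2}{x_i-x_j}\frac{\partial}{\partial x_i},\qquad e_\lambda=d_\lambda+a|\lambda|.$$ If $e_\mu\ne e_\lambda$ for all partitions $\mu\subset\lambda$, then $Y_\lambda$ is the unique symmetric polynomial such that $Y_\lambda=P_\lambda+\sum_{\mu\subset\lambda}u_{\lambda\mu}P_\mu$ for some coefficients $u_{\lambda\mu}$, and $Y_\lambda$ is an eigenfunction of $D^B$. Standing assumption: $a,\kappa$ are such that the Jack polynomials $P_\mu$ ($\mu\subseteq\lambda$), with $P_\mu(1^n)\neq0$, and the polynomial $Y_\lambda$ are well-defined (in particular $e_\mu\ne e_\lambda$ for all $\mu\subset\lambda$). *)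

theory Defs
  imports "HOL-Analysis.Analysis" "HOL-Combinatorics.Permutations"
begin

text \<open>
  Points of n-space are functions \<open>x :: nat \<Rightarrow> real\<close> of which only the coordinates in \<open>{1..n}\<close>
  matter.  Polynomials are represented by the functions they induce, which is harmless over
  the infinite field of real numbers.

  A partition is padded with zeros outside \<open>{1..n}\<close>.  Hence the inclusion of partitions is the
  pointwise order \<open>\<le>\<close> of the function space, and strict inclusion is \<open><\<close>; the dominance order
  is written \<open>dominated n\<close>.
\<close>

definition is_partition :: "nat \<Rightarrow> (nat \<Rightarrow> nat) \<Rightarrow> bool" where
  "is_partition n lam \<longleftrightarrow>
     (\<forall>i j. 1 \<le> i \<and> i \<le> j \<and> j \<le> n \<longrightarrow> lam j \<le> lam i) \<and> (\<forall>i. i \<notin> {1..n} \<longrightarrow> lam i = 0)"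

definition weight :: "nat \<Rightarrow> (nat \<Rightarrow> nat) \<Rightarrow> nat" where
  "weight n lam = (\<Sum>i=1..n. lam i)"

definition dominated :: "nat \<Rightarrow> (nat \<Rightarrow> nat) \<Rightarrow> (nat \<Rightarrow> nat) \<Rightarrow> bool" where
  "dominated n mu lam \<longleftrightarrow>
     weight n mu = weight n lam \<and> (\<forall>k\<in>{1..n}. (\<Sum>i=1..k. mu i) \<le> (\<Sum>i=1..k. lam i))"

text \<open>The sum runs over the distinct rearrangements of the exponent vector, each taken once.\<close>

definition monomial_sym :: "nat \<Rightarrow> (nat \<Rightarrow> nat) \<Rightarrow> (nat \<Rightarrow> real) \<Rightarrow> real" where
  "monomial_sym n lam x = (\<Sum>\<alpha> \<in> {lam \<circ> \<sigma> | \<sigma>. \<sigma> permutes {1..n}}. \<Prod>i=1..n. x i ^ \<alpha> i)"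

definition partial :: "nat \<Rightarrow> ((nat \<Rightarrow> real) \<Rightarrow> real) \<Rightarrow> (nat \<Rightarrow> real) \<Rightarrow> real" where
  "partial i f x = deriv (\<lambda>t. f (x(i := t))) (x i)"

definition op_E1 :: "nat \<Rightarrow> ((nat \<Rightarrow> real) \<Rightarrow> real) \<Rightarrow> (nat \<Rightarrow> real) \<Rightarrow> real" where
  "op_E1 n f x = (\<Sum>i=1..n. x i * partial i f x)"

definition op_D2 :: "nat \<Rightarrow> real \<Rightarrow> ((nat \<Rightarrow> real) \<Rightarrow> real) \<Rightarrow> (nat \<Rightarrow> real) \<Rightarrow> real" where
  "op_D2 n \<kappa> f x =
     (\<Sum>i=1..n. (x i)\<^sup>2 * partial i (partial i f) x)
     + 2 * \<kappa> * (\<Sum>i=1..n. \<Sum>j\<in>{1..n} - {i}. (x i)\<^sup>2 / (x i - x j) * partial i f x)"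

definition op_DB :: "nat \<Rightarrow> real \<Rightarrow> real \<Rightarrow> ((nat \<Rightarrow> real) \<Rightarrow> real) \<Rightarrow> (nat \<Rightarrow> real) \<Rightarrow> real" where
  "op_DB n a \<kappa> f x =
     (\<Sum>i=1..n. (x i)\<^sup>2 * partial i (partial i f) x)
     + (\<Sum>i=1..n. (a * x i + 2) * partial i f x)
     + 2 * \<kappa> * (\<Sum>i=1..n. \<Sum>j\<in>{1..n} - {i}. (x i)\<^sup>2 / (x i - x j) * partial i f x)"

text \<open>
  The coefficients \<open>x\<^sub>i\<^sup>2 / (x\<^sub>i - x\<^sub>j)\<close> only make sense off the diagonals, so the eigenvalue
  equation is required at points with pairwise distinct coordinates.  These are dense, so for
  polynomials this is the identity of polynomials.
\<close>

definition eigenfunction ::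
  "nat \<Rightarrow> (((nat \<Rightarrow> real) \<Rightarrow> real) \<Rightarrow> (nat \<Rightarrow> real) \<Rightarrow> real) \<Rightarrow> ((nat \<Rightarrow> real) \<Rightarrow> real) \<Rightarrow> bool" where
  "eigenfunction n D f \<longleftrightarrow>
     (\<exists>x. f x \<noteq> 0) \<and> (\<exists>c. \<forall>x. inj_on x {1..n} \<longrightarrow> D f x = c * f x)"

definition is_jack :: "nat \<Rightarrow> real \<Rightarrow> (nat \<Rightarrow> nat) \<Rightarrow> ((nat \<Rightarrow> real) \<Rightarrow> real) \<Rightarrow> bool" where
  "is_jack n \<kappa> lam P \<longleftrightarrow>
     (\<exists>c. P = (\<lambda>x. monomial_sym n lam x +
                (\<Sum>mu | is_partition n mu \<and> dominated n mu lam \<and> mu \<noteq> lam.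
                   c mu * monomial_sym n mu x))) \<and>
     eigenfunction n (op_E1 n) P \<and> eigenfunction n (op_D2 n \<kappa>) P"

definition jack :: "nat \<Rightarrow> real \<Rightarrow> (nat \<Rightarrow> nat) \<Rightarrow> (nat \<Rightarrow> real) \<Rightarrow> real" where
  "jack n \<kappa> lam = (THE P. is_jack n \<kappa> lam P)"

definition jack_at_one :: "nat \<Rightarrow> real \<Rightarrow> (nat \<Rightarrow> nat) \<Rightarrow> real" where
  "jack_at_one n \<kappa> lam = jack n \<kappa> lam (\<lambda>_. 1)"

definition eigval_d :: "nat \<Rightarrow> real \<Rightarrow> (nat \<Rightarrow> nat) \<Rightarrow> real" where
  "eigval_d n \<kappa> lam =
     (\<Sum>i=1..n. real (lam i) * (real (lam i) - 1 + 2 * \<kappa> * (real n - real i)))"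

definition eigval_e :: "nat \<Rightarrow> real \<Rightarrow> real \<Rightarrow> (nat \<Rightarrow> nat) \<Rightarrow> real" where
  "eigval_e n a \<kappa> lam = eigval_d n \<kappa> lam + a * real (weight n lam)"

text \<open>
  The defining relation of the generalised binomial coefficients: \<open>b mu\<close> is the coefficient
  ``\<open>lam\<close> over \<open>mu\<close>''.  When the Jack polynomials involved exist and do not vanish at
  \<open>(1,\<dots>,1)\<close>, their linear independence makes the values \<open>b mu\<close> with \<open>mu \<le> lam\<close> unique; the
  other values are unconstrained and never used.
\<close>

definition gen_binomials :: "nat \<Rightarrow> real \<Rightarrow> (nat \<Rightarrow> nat) \<Rightarrow> ((nat \<Rightarrow> nat) \<Rightarrow> real) \<Rightarrow> bool" where
  "gen_binomials n \<kappa> lam b \<longleftrightarrow>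
     (\<forall>x. jack n \<kappa> lam (\<lambda>i. x i + 1) / jack_at_one n \<kappa> lam =
          (\<Sum>mu | is_partition n mu \<and> mu \<le> lam. b mu * (jack n \<kappa> mu x / jack_at_one n \<kappa> mu)))"

definition is_bessel :: "nat \<Rightarrow> real \<Rightarrow> real \<Rightarrow> (nat \<Rightarrow> nat) \<Rightarrow> ((nat \<Rightarrow> real) \<Rightarrow> real) \<Rightarrow> bool" where
  "is_bessel n a \<kappa> lam Y \<longleftrightarrow>
     (\<exists>u. Y = (\<lambda>x. jack n \<kappa> lam x +
                (\<Sum>mu | is_partition n mu \<and> mu < lam. u mu * jack n \<kappa> mu x))) \<and>
     eigenfunction n (op_DB n a \<kappa>) Y"

definition bessel :: "nat \<Rightarrow> real \<Rightarrow> real \<Rightarrow> (nat \<Rightarrow> nat) \<Rightarrow> (nat \<Rightarrow> real) \<Rightarrow> real" where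
  "bessel n a \<kappa> lam = (THE Y. is_bessel n a \<kappa> lam Y)"

text \<open>A standard tableau is the list of the members of its chain, from \<open>lam\<close> down to \<open>mu\<close>.\<close>

definition std_tableaux :: "nat \<Rightarrow> (nat \<Rightarrow> nat) \<Rightarrow> (nat \<Rightarrow> nat) \<Rightarrow> (nat \<Rightarrow> nat) list set" where
  "std_tableaux n lam mu =
     {T. length T = (weight n lam - weight n mu) + 1 \<and>
         T ! 0 = lam \<and> T ! (weight n lam - weight n mu) = mu \<and>
         (\<forall>\<nu>\<in>set T. is_partition n \<nu>) \<and>
         (\<forall>i\<in>{1..weight n lam - weight n mu}.
            T ! i < T ! (i - 1) \<and> weight n (T ! (i - 1)) = weight n (T ! i) + 1)}"

end

theory Submission
  imports Defs
begin

text \<open>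
  Write \<open>D\<^sup>B = D\<^sub>2 + a E\<^sub>1 + 2 E\<^sub>0\<close> with \<open>E\<^sub>0 = \<Sum>\<^sub>i \<partial>\<^sub>i\<close>.  The first two operators are diagonal on Jack
  polynomials, while \<open>E\<^sub>0\<close> is the infinitesimal shift, so the defining relation of the binomial
  coefficients expresses \<open>E\<^sub>0 P\<^sub>\<mu>\<close> through the \<open>P\<^sub>\<nu>\<close> with one box less.  Comparing
  coefficients in \<open>D\<^sup>B Y = c Y\<close> gives \<open>c = e\<^sub>\<lambda>\<close> and a recursion that determines \<open>u\<^sub>\<lambda>\<^sub>\<nu>\<close> from the
  \<open>u\<^sub>\<lambda>\<^sub>\<mu>\<close> with one box more; removing the last step of a tableau shows that the
  tableau sum solves it.
\<close>

section \<open>Partial derivatives of polynomial functions\<close>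

text \<open>The definitions grant little about Jack polynomials: triangularity in the m_\<nu> and
  some unnamed eigenvalue of D_2, with the eigenvalue equation only at points with distinct
  coordinates. The values d_\<mu> and the linear independence needed to compare coefficients must
  therefore be derived. Both come from growth rates along x_i = t^(B^(n-i)) for large t: this curve
  avoids the diagonals, turns the partial dominance order into a comparison of numbers, and makes
  every x_i/(x_i - x_j) converge, so that no division by x_i - x_j has to be carried out on
  polynomials. Since Y_\<lambda> is given by a definite description, exhibiting a solution of the
  recursion is not enough. The eigenvalue equation with an arbitrary c is shown equivalent to a
  linear system for the coefficients, triangular in the number of boxes, and e_\<mu> \<noteq>
  e_\<lambda> makes its solution with leading coefficient 1 unique.\<close>

definition xmonom :: "nat \<Rightarrow> (nat \<Rightarrow> nat) \<Rightarrow> (nat \<Rightarrow> real) \<Rightarrow> real" where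
  "xmonom n \<alpha> x = (\<Prod>i=1..n. x i ^ \<alpha> i)"

lemma monom_split:
  assumes "i \<in> {1..n}"
  shows "xmonom n \<alpha> x = x i ^ \<alpha> i * (\<Prod>j\<in>{1..n}-{i}. x j ^ \<alpha> j)"
  unfolding xmonom_def using assms by (subst prod.remove[of _ i]) auto

text \<open>For \<open>\<alpha> i = 0\<close> the truncated \<open>\<alpha> i - 1\<close> is 0, and
  the factor \<open>real (\<alpha> i)\<close> makes the derivative vanish as it should.\<close>

lemma DERIV_monom:
  assumes "i \<in> {1..n}"
  shows "((\<lambda>t. xmonom n \<alpha> (x(i := t))) has_real_derivative
      real (\<alpha> i) * xmonom n (\<alpha>(i := \<alpha> i - 1)) x) (at (x i))"
proof -
  let ?R = "\<Prod>j\<in>{1..n}-{i}. x j ^ \<alpha> j"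
  have 1: "xmonom n \<alpha> (x(i := t)) = t ^ \<alpha> i * ?R" for t
    unfolding monom_split[OF assms] by (auto intro!: prod.cong)
  have 2: "xmonom n (\<alpha>(i := \<alpha> i - 1)) x = x i ^ (\<alpha> i - 1) * ?R"
    unfolding monom_split[OF assms] by (auto intro!: prod.cong)
  show ?thesis
    unfolding 1 2 by (auto intro!: derivative_eq_intros)
qed

lemma partial_monom:
  assumes "i \<in> {1..n}"
  shows "partial i (xmonom n \<alpha>) = (\<lambda>x. real (\<alpha> i) * xmonom n (\<alpha>(i := \<alpha> i - 1)) x)"
  unfolding partial_def using DERIV_imp_deriv[OF DERIV_monom[OF assms]] by auto

text \<open>Multiplication by x_i restores the exponent lost in the derivative, so x_i times the
  derivative keeps a polynomial on the same set of exponents and only rescales its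
  coefficients.\<close>

lemma euler_monom:
  assumes "i \<in> {1..n}"
  shows "x i * partial i (xmonom n \<alpha>) x = real (\<alpha> i) * xmonom n \<alpha> x"
proof (cases "\<alpha> i")
  case (Suc k)
  have "(\<Prod>j\<in>{1..n}-{i}. x j ^ (\<alpha>(i := k)) j) = (\<Prod>j\<in>{1..n}-{i}. x j ^ \<alpha> j)"
    by (rule prod.cong) auto
  with Suc show ?thesis
    unfolding partial_monom[OF assms] monom_split[OF assms] by simp
qed (simp add: partial_monom[OF assms])

text \<open>The linear span of the monomials. \<open>partial\<close> is built on
  \<open>deriv\<close>, which carries information only where a derivative exists; membership here
  provides it, and closure under \<open>partial\<close> provides it for second derivatives.\<close>

inductive polyfun :: "nat \<Rightarrow> ((nat \<Rightarrow> real) \<Rightarrow> real) \<Rightarrow> bool" for n where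
  monom: "polyfun n (\<lambda>x. c * xmonom n \<alpha> x)"
| add: "polyfun n f \<Longrightarrow> polyfun n g \<Longrightarrow> polyfun n (\<lambda>x. f x + g x)"

lemma polyfun_monom: "polyfun n (xmonom n \<alpha>)"
  using polyfun.monom[of n 1 \<alpha>] by simp

lemma polyfun_sum:
  assumes "\<And>k. k \<in> K \<Longrightarrow> polyfun n (f k)"
  shows "polyfun n (\<lambda>x. \<Sum>k\<in>K. f k x)"
proof -
  have 0: "polyfun n (\<lambda>x. 0)" using polyfun.monom[of n 0] by simp
  show ?thesis
    using assms by (induction K rule: infinite_finite_induct) (auto intro: 0 polyfun.add)
qed

lemma DERIV_partial:
  assumes "polyfun n f" "i \<in> {1..n}"
  shows "((\<lambda>t. f (x(i := t))) has_real_derivative partial i f x) (at (x i))"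
  using assms(1)
proof induction
  case (monom c \<alpha>)
  have "((\<lambda>t. c * xmonom n \<alpha> (x(i := t))) has_real_derivative
      c * (real (\<alpha> i) * xmonom n (\<alpha>(i := \<alpha> i - 1)) x)) (at (x i))"
    by (intro DERIV_cmult DERIV_monom assms)
  then show ?case unfolding partial_def using DERIV_imp_deriv by metis
next
  case (add f g)
  note D = DERIV_add[OF add.IH]
  show ?case unfolding partial_def[of i "\<lambda>x. f x + g x"] DERIV_imp_deriv[OF D] by (rule D)
qed

lemma partial_sum:
  assumes "\<And>k. k \<in> K \<Longrightarrow> polyfun n (f k)" "i \<in> {1..n}"
  shows "partial i (\<lambda>x. \<Sum>k\<in>K. c k * f k x) = (\<lambda>x. \<Sum>k\<in>K. c k * partial i (f k) x)"
proof
  fix x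
  have "((\<lambda>t. \<Sum>k\<in>K. c k * f k (x(i := t))) has_real_derivative
      (\<Sum>k\<in>K. c k * partial i (f k) x)) (at (x i))"
    by (intro DERIV_sum DERIV_cmult DERIV_partial[where n=n] assms)
  from DERIV_imp_deriv[OF this]
  show "partial i (\<lambda>x. \<Sum>k\<in>K. c k * f k x) x = (\<Sum>k\<in>K. c k * partial i (f k) x)"
    unfolding partial_def[of i "\<lambda>x. \<Sum>k\<in>K. c k * f k x"] .
qed

lemma partial_cmult:
  assumes "polyfun n f" "i \<in> {1..n}"
  shows "partial i (\<lambda>x. c * f x) = (\<lambda>x. c * partial i f x)"
  using partial_sum[of "{()}" n "\<lambda>_. f" i "\<lambda>_. c"] assms by simp

lemma partial_add:
  assumes "polyfun n f" "polyfun n g" "i \<in> {1..n}"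
  shows "partial i (\<lambda>x. f x + g x) = (\<lambda>x. partial i f x + partial i g x)"
  using partial_sum[of "{True, False}" n "\<lambda>b. if b then f else g" i "\<lambda>_. 1"] assms by simp

lemma polyfun_partial:
  assumes "polyfun n f" "i \<in> {1..n}"
  shows "polyfun n (partial i f)"
  using assms(1)
proof induction
  case (monom c \<alpha>)
  have "partial i (\<lambda>x. c * xmonom n \<alpha> x) = (\<lambda>x. (c * real (\<alpha> i)) * xmonom n (\<alpha>(i := \<alpha> i - 1)) x)"
    by (simp add: partial_cmult[OF polyfun_monom assms(2)] partial_monom[OF assms(2)] mult.assoc)
  then show ?case by (metis polyfun.monom)
next
  case (add f g)
  show ?case unfolding partial_add[OF add.hyps assms(2)] by (rule polyfun.add[OF add.IH])
qed

lemma partial2_sum: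
  assumes "\<And>k. k \<in> K \<Longrightarrow> polyfun n (f k)" "i \<in> {1..n}"
  shows "partial i (partial i (\<lambda>x. \<Sum>k\<in>K. c k * f k x)) =
      (\<lambda>x. \<Sum>k\<in>K. c k * partial i (partial i (f k)) x)"
proof -
  have "polyfun n (partial i (f k))" if "k \<in> K" for k
    using assms that by (blast intro: polyfun_partial)
  from partial_sum[OF this assms(2)] show ?thesis
    by (simp add: partial_sum[OF assms])
qed

text \<open>Two uses of the Euler identity: one x_i goes with the outer derivative and gives the
  factor \<open>\<alpha> i - 1\<close>, the other goes with the inner derivative and gives
  \<open>\<alpha> i\<close>.\<close>

lemma euler2_monom:
  assumes "i \<in> {1..n}"
  shows "(x i)\<^sup>2 * partial i (partial i (xmonom n \<alpha>)) x =
      real (\<alpha> i) * (real (\<alpha> i) - 1) * xmonom n \<alpha> x"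
proof (cases "\<alpha> i")
  case 0
  then show ?thesis
    \<comment> \<open>The first derivative is the zero function; the instance with factor 0
      differentiates it once more.\<close>
    using partial_cmult[OF polyfun_monom assms, of 0] by (simp add: partial_monom[OF assms])
next
  case (Suc k)
  have "x i * partial i (partial i (xmonom n \<alpha>)) x
      = real (Suc k) * (x i * partial i (xmonom n (\<alpha>(i := k))) x)"
    unfolding partial_monom[OF assms, of \<alpha>]
    by (simp add: partial_cmult[OF polyfun_monom assms] Suc)
  also have "\<dots> = real k * partial i (xmonom n \<alpha>) x"
    unfolding euler_monom[OF assms] by (simp add: partial_monom[OF assms] Suc)
  finally have "(x i)\<^sup>2 * partial i (partial i (xmonom n \<alpha>)) x
      = real k * (x i * partial i (xmonom n \<alpha>) x)"
    by (simp add: power2_eq_square mult_ac)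
  then show ?thesis unfolding euler_monom[OF assms] by (simp add: Suc)
qed

text \<open>In the product rule for the product of the (x_i + s)^(\<alpha> i) at s = 0, the i-th
  summand is the i-th partial derivative. This is what allows E_0 to be computed from the shift
  relation.\<close>

lemma DERIV_diagonal:
  assumes "polyfun n f"
  shows "((\<lambda>s. f (\<lambda>i. x i + s)) has_real_derivative (\<Sum>i=1..n. partial i f x)) (at 0)"
  using assms
proof induction
  case (monom c \<alpha>)
  have "((\<lambda>s. xmonom n \<alpha> (\<lambda>i. x i + s)) has_real_derivative
      (\<Sum>i\<in>{1..n}. (real (\<alpha> i) * (x i + 0) ^ (\<alpha> i - 1)) * (\<Prod>j\<in>{1..n}-{i}. (x j + 0) ^ \<alpha> j)))
      (at 0)"
    unfolding xmonom_def
    by (rule has_field_derivative_prod) (auto intro!: derivative_eq_intros)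
  also have "(\<Sum>i\<in>{1..n}. (real (\<alpha> i) * (x i + 0) ^ (\<alpha> i - 1)) * (\<Prod>j\<in>{1..n}-{i}. (x j + 0) ^ \<alpha> j))
      = (\<Sum>i=1..n. partial i (xmonom n \<alpha>) x)"
    by (intro sum.cong refl)
      (auto simp: partial_monom monom_split mult.assoc intro!: prod.cong)
  finally have "((\<lambda>s. c * xmonom n \<alpha> (\<lambda>i. x i + s)) has_real_derivative
      c * (\<Sum>i=1..n. partial i (xmonom n \<alpha>) x)) (at 0)"
    by (rule DERIV_cmult)
  then show ?case
    by (simp add: partial_cmult[OF polyfun_monom] sum_distrib_left)
next
  case (add f g)
  show ?case
    using DERIV_add[OF add.IH] by (simp add: partial_add[OF add.hyps] sum.distrib)
qed

section \<open>The operator D^B: decomposition and linearity\<close>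

lemma op_DB_decompose:
  "op_DB n a \<kappa> f x = op_D2 n \<kappa> f x + a * op_E1 n f x + 2 * (\<Sum>i=1..n. partial i f x)"
  unfolding op_DB_def op_D2_def op_E1_def
  by (simp add: distrib_right sum.distrib sum_distrib_left mult.assoc)

lemma op_DB_sum:
  assumes "\<And>k. k \<in> K \<Longrightarrow> polyfun n (f k)"
  shows "op_DB n a \<kappa> (\<lambda>x. \<Sum>k\<in>K. c k * f k x) x = (\<Sum>k\<in>K. c k * op_DB n a \<kappa> (f k) x)"
proof -
  let ?g = "\<lambda>x. \<Sum>k\<in>K. c k * f k x"
  have "(\<Sum>i=1..n. (x i)\<^sup>2 * partial i (partial i ?g) x)
      = (\<Sum>i=1..n. \<Sum>k\<in>K. c k * ((x i)\<^sup>2 * partial i (partial i (f k)) x))"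
    by (intro sum.cong refl) (simp add: partial2_sum[OF assms] sum_distrib_left mult_ac)
  also have "\<dots> = (\<Sum>k\<in>K. c k * (\<Sum>i=1..n. (x i)\<^sup>2 * partial i (partial i (f k)) x))"
    by (subst sum.swap) (simp add: sum_distrib_left)
  finally have 1: "(\<Sum>i=1..n. (x i)\<^sup>2 * partial i (partial i ?g) x) = \<dots>" .
  \<comment> \<open>Serves both first-order parts: \<open>h i\<close> is a x_i + 2 in one, and in
    the other the sum over j of x_i^2/(x_i - x_j), once the derivative is pulled out of the inner
    sum.\<close>
  have first_order: "(\<Sum>i=1..n. h i * partial i ?g x) =
      (\<Sum>k\<in>K. c k * (\<Sum>i=1..n. h i * partial i (f k) x))" for h
  proof -
    have "(\<Sum>i=1..n. h i * partial i ?g x) = (\<Sum>i=1..n. \<Sum>k\<in>K. c k * (h i * partial i (f k) x))"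
      by (intro sum.cong refl) (simp add: partial_sum[OF assms] sum_distrib_left mult_ac)
    then show ?thesis
      by (subst (asm) sum.swap) (simp add: sum_distrib_left)
  qed
  show ?thesis
    unfolding op_DB_def 1 sum_distrib_right[symmetric] first_order
    by (simp add: sum_distrib_left distrib_left sum.distrib mult_ac)
qed

section \<open>Exponents dominated by a partition\<close>

definition lower_exps :: "nat \<Rightarrow> (nat \<Rightarrow> nat) \<Rightarrow> (nat \<Rightarrow> nat) set" where
  "lower_exps n mu = {\<alpha>. (\<forall>i. i \<notin> {1..n} \<longrightarrow> \<alpha> i = 0) \<and> dominated n \<alpha> mu}"

lemma finite_bounded_exps: "finite {\<alpha>::nat \<Rightarrow> nat. (\<forall>i. i \<notin> {1..n} \<longrightarrow> \<alpha> i = 0) \<and> (\<forall>i\<in>{1..n}. \<alpha> i \<le> N)}"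
  by (rule finite_subset[OF _ finite_set_of_finite_funs[of "{1..n}" "{..N}" 0]]) auto

lemma finite_lower_exps: "finite (lower_exps n mu)"
proof (rule finite_subset[OF _ finite_bounded_exps[of n "weight n mu"]], safe)
  fix \<alpha> i assume "\<alpha> \<in> lower_exps n mu" "i \<in> {1..n}"
  moreover have "\<alpha> i \<le> weight n \<alpha>"
    unfolding weight_def using \<open>i \<in> {1..n}\<close> by (intro member_le_sum) auto
  ultimately show "\<alpha> i \<le> weight n mu" by (simp add: lower_exps_def dominated_def)
qed (auto simp: lower_exps_def)

text \<open>Exchange argument: the indices of S beyond k are as many as those up to k missing from
  S; parts at the former are at most \<open>nu k\<close>, parts at the latter at least
  \<open>nu k\<close>.\<close>

lemma partition_sum_le_prefix:
  assumes "is_partition n nu" "S \<subseteq> {1..n}" "card S = k" "k \<in> {1..n}"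
  shows "(\<Sum>i\<in>S. nu i) \<le> (\<Sum>i=1..k. nu i)"
proof -
  have fin: "finite S" using assms(2) finite_subset by blast
  have cards: "card (S - {1..k}) = card ({1..k} - S)"
    using card_Diff_subset_Int[of S "{1..k}"] card_Diff_subset_Int[of "{1..k}" S] fin assms(3)
    by (simp add: Int_commute)
  have "(\<Sum>i\<in>S - {1..k}. nu i) \<le> (\<Sum>i\<in>S - {1..k}. nu k)"
  proof (rule sum_mono)
    fix i assume "i \<in> S - {1..k}"
    then have "1 \<le> k" "k \<le> i" "i \<le> n" using assms by auto
    then show "nu i \<le> nu k" using assms(1) by (auto simp: is_partition_def)
  qed
  also have "\<dots> = (\<Sum>i\<in>{1..k} - S. nu k)" by (simp only: sum_constant cards)
  also have "\<dots> \<le> (\<Sum>i\<in>{1..k} - S. nu i)"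
    using assms by (intro sum_mono) (auto simp: is_partition_def)
  finally have le: "(\<Sum>i\<in>S - {1..k}. nu i) \<le> (\<Sum>i\<in>{1..k} - S. nu i)" .
  have "(\<Sum>i\<in>S. nu i) = (\<Sum>i\<in>S \<inter> {1..k}. nu i) + (\<Sum>i\<in>S - {1..k}. nu i)"
    using sum.Int_Diff[OF fin] .
  moreover have "(\<Sum>i\<in>{1..k}. nu i) = (\<Sum>i\<in>{1..k} \<inter> S. nu i) + (\<Sum>i\<in>{1..k} - S. nu i)"
    using sum.Int_Diff[of "{1..k}"] by simp
  ultimately show ?thesis using le by (simp add: Int_commute)
qed

text \<open>The first k entries of a rearrangement are k of the parts of \<open>nu\<close>, so their
  sum is at most that of the k largest.\<close>

lemma rearrangement_in_lower_exps:
  assumes "is_partition n nu" "dominated n nu mu" "\<sigma> permutes {1..n}"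
  shows "nu \<circ> \<sigma> \<in> lower_exps n mu"
proof -
  have w: "weight n (nu \<circ> \<sigma>) = weight n nu"
    unfolding weight_def using sum.permute[OF assms(3), of nu] by simp
  have "(\<Sum>i=1..k. (nu \<circ> \<sigma>) i) \<le> (\<Sum>i=1..k. nu i)" if k: "k \<in> {1..n}" for k
  proof -
    have inj: "inj_on \<sigma> {1..k}" using permutes_inj[OF assms(3)] by (rule inj_on_subset) simp
    have "(\<Sum>i=1..k. (nu \<circ> \<sigma>) i) = (\<Sum>i\<in>\<sigma> ` {1..k}. nu i)"
      using sum.reindex[OF inj, of nu] by simp
    also have "\<dots> \<le> (\<Sum>i=1..k. nu i)"
    proof (rule partition_sum_le_prefix[OF assms(1) _ _ k])
      have "\<sigma> ` {1..k} \<subseteq> \<sigma> ` {1..n}" using k by (intro image_mono) auto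
      then show "\<sigma> ` {1..k} \<subseteq> {1..n}" unfolding permutes_image[OF assms(3)] .
      show "card (\<sigma> ` {1..k}) = k" using card_image[OF inj] by simp
    qed
    finally show ?thesis .
  qed
  then have "dominated n (nu \<circ> \<sigma>) mu"
    using assms(2) w unfolding dominated_def by (fastforce intro: order_trans)
  moreover have "(nu \<circ> \<sigma>) i = 0" if "i \<notin> {1..n}" for i
    using that assms(1) permutes_not_in[OF assms(3) that] by (simp add: is_partition_def)
  ultimately show ?thesis by (simp add: lower_exps_def)
qed

lemma partition_in_lower_exps: "is_partition n mu \<Longrightarrow> mu \<in> lower_exps n mu"
  by (auto simp: lower_exps_def is_partition_def dominated_def)

text \<open>The power of t obtained from x^\<alpha> by substituting x_i = t^(B^(n-i)).\<close>

definition wt :: "nat \<Rightarrow> nat \<Rightarrow> (nat \<Rightarrow> nat) \<Rightarrow> nat" where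
  "wt n B \<alpha> = (\<Sum>i=1..n. B ^ (n - i) * \<alpha> i)"

lemma summation_by_parts:
  fixes w d :: "nat \<Rightarrow> int"
  shows "(\<Sum>i=1..m. w i * d i) =
    (\<Sum>k\<in>{1..<m}. (w k - w (Suc k)) * (\<Sum>i=1..k. d i)) + w m * (\<Sum>i=1..m. d i)"
proof (induction m)
  case (Suc m)
  then show ?case by (cases m) (simp_all add: algebra_simps)
qed simp

text \<open>The partial sums S_k of \<open>mu\<close> minus \<alpha> are nonnegative, with S_n = 0.
  Summation by parts writes the difference of weights as a sum of S_k times w_k - w_(k+1), which is
  positive since powers of B decrease strictly along the parts; some S_k is nonzero because the
  vectors differ.\<close>

lemma wt_less_of_dominated:
  assumes "2 \<le> B" "mu \<in> lower_exps n mu" "\<alpha> \<in> lower_exps n mu" "\<alpha> \<noteq> mu"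
  shows "wt n B \<alpha> < wt n B mu"
proof -
  define d where "d i = int (mu i) - int (\<alpha> i)" for i
  define S where "S k = (\<Sum>i=1..k. d i)" for k
  define w where "w i = int B ^ (n - i)" for i
  have S_eq: "S k = int (\<Sum>i=1..k. mu i) - int (\<Sum>i=1..k. \<alpha> i)" for k
    by (simp add: S_def d_def sum_subtractf)
  have S_nonneg: "S k \<ge> 0" if "k \<in> {1..n}" for k
  proof -
    have "(\<Sum>i=1..k. \<alpha> i) \<le> (\<Sum>i=1..k. mu i)"
      using assms(3) that by (simp add: lower_exps_def dominated_def)
    then show ?thesis unfolding S_eq by (simp only: diff_ge_0_iff_ge of_nat_le_iff)
  qed
  have S_n: "S n = 0"
    using assms(3) S_eq[of n] by (simp add: lower_exps_def dominated_def weight_def)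
  have w_less: "w (Suc k) < w k" if "k \<in> {1..<n}" for k
    using that assms(1) by (simp add: w_def power_strict_increasing diff_less_mono2)
  have "int (wt n B mu) - int (wt n B \<alpha>) = (\<Sum>i=1..n. w i * d i)"
    by (simp add: wt_def w_def d_def right_diff_distrib sum_subtractf)
  also have "\<dots> = (\<Sum>k\<in>{1..<n}. (w k - w (Suc k)) * S k)"
    unfolding summation_by_parts using S_n by (simp add: S_def)
  also have "\<dots> > 0"
  proof -
    have "\<exists>k\<in>{1..<n}. S k \<noteq> 0"
    proof (rule ccontr)
      assume "\<not> ?thesis"
      then have S0: "S k = 0" if "k \<le> n" for k
        using that S_n by (cases "k = 0 \<or> k = n") (auto simp: S_def)
      have "mu i = \<alpha> i" for i
      proof (cases "i \<in> {1..n}")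
        case True
        then obtain j where j: "i = Suc j" "Suc j \<le> n" by (cases i) auto
        then have "d i = S (Suc j) - S j" by (simp add: S_def)
        then show ?thesis using j S0[of j] S0[of "Suc j"] by (simp add: d_def)
      next
        case False
        then show ?thesis using assms(2,3) by (simp add: lower_exps_def)
      qed
      then show False using assms(4) by auto
    qed
    then obtain k where k: "k \<in> {1..<n}" "S k \<noteq> 0" by blast
    show ?thesis
    proof (rule sum_pos2[OF _ k(1)])
      show "0 < (w k - w (Suc k)) * S k"
        using k w_less[OF k(1)] S_nonneg[of k] by (intro mult_pos_pos) auto
      show "0 \<le> (w i - w (Suc i)) * S i" if "i \<in> {1..<n}" for i
        using that w_less[OF that] S_nonneg[of i] by (intro mult_nonneg_nonneg) auto
    qed simp
  qed
  finally show ?thesis by simp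
qed

text \<open>Uniqueness of digits in base B: the last entry is the remainder modulo B, and the
  quotient is the weight of the remaining entries.\<close>

lemma wt_inj:
  assumes "wt n B \<alpha> = wt n B \<beta>" "\<forall>i\<in>{1..n}. \<alpha> i < B \<and> \<beta> i < B"
  shows "\<forall>i\<in>{1..n}. \<alpha> i = \<beta> i"
  using assms
proof (induction n)
  case (Suc n)
  have horner: "wt (Suc n) B f = B * wt n B f + f (Suc n)" for f
  proof -
    have "(\<Sum>i=1..n. B ^ (Suc n - i) * f i) = (\<Sum>i=1..n. B * (B ^ (n - i) * f i))"
      by (intro sum.cong refl) (auto simp: Suc_diff_le)
    then show ?thesis by (simp add: wt_def sum_distrib_left)
  qed
  have lt: "\<alpha> (Suc n) < B" "\<beta> (Suc n) < B" using Suc.prems(2) by auto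
  have eq: "B * wt n B \<alpha> + \<alpha> (Suc n) = B * wt n B \<beta> + \<beta> (Suc n)"
    using Suc.prems(1) by (simp add: horner)
  have "\<alpha> (Suc n) = \<beta> (Suc n)"
    using arg_cong[OF eq, of "\<lambda>k. k mod B"] lt by simp
  moreover have "wt n B \<alpha> = wt n B \<beta>"
    using arg_cong[OF eq, of "\<lambda>k. k div B"] lt by simp
  moreover have "\<forall>i\<in>{1..n}. \<alpha> i < B \<and> \<beta> i < B" using Suc.prems(2) by auto
  ultimately have "\<alpha> (Suc n) = \<beta> (Suc n)" "\<forall>i\<in>{1..n}. \<alpha> i = \<beta> i" using Suc.IH by blast+
  then show ?case by (simp add: atLeastAtMostSuc_conv)
qed simp

section \<open>Jack polynomials as sums of monomials\<close>

lemma monomial_sym_expand: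
  assumes "is_partition n nu" "dominated n nu mu"
  shows "monomial_sym n nu x = (\<Sum>\<alpha>\<in>lower_exps n mu.
    of_bool (\<exists>\<sigma>. \<sigma> permutes {1..n} \<and> \<alpha> = nu \<circ> \<sigma>) * xmonom n \<alpha> x)"
proof -
  have sub: "{nu \<circ> \<sigma> |\<sigma>. \<sigma> permutes {1..n}} \<subseteq> lower_exps n mu"
    using rearrangement_in_lower_exps[OF assms] by blast
  show ?thesis
    unfolding monomial_sym_def xmonom_def[symmetric]
    by (rule sum.mono_neutral_cong_left) (use sub finite_lower_exps in auto)
qed

text \<open>All m_\<nu> involved are written over the common index set
  \<open>lower_exps n mu\<close> and added termwise. The coefficient of x^\<mu> stays 1 because
  \<mu> is no rearrangement of another partition that it dominates.\<close>

lemma is_jack_expansion: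
  assumes "is_partition n mu" "is_jack n \<kappa> mu P"
  obtains c where "c mu = 1" "P = (\<lambda>x. \<Sum>\<alpha>\<in>lower_exps n mu. c \<alpha> * xmonom n \<alpha> x)"
proof -
  define M where "M = {nu. is_partition n nu \<and> dominated n nu mu \<and> nu \<noteq> mu}"
  define b :: "(nat \<Rightarrow> nat) \<Rightarrow> (nat \<Rightarrow> nat) \<Rightarrow> real"
    where "b nu \<alpha> = of_bool (\<exists>\<sigma>. \<sigma> permutes {1..n} \<and> \<alpha> = nu \<circ> \<sigma>)" for nu \<alpha>
  obtain c where P: "P = (\<lambda>x. monomial_sym n mu x + (\<Sum>nu\<in>M. c nu * monomial_sym n nu x))"
    using assms(2) unfolding is_jack_def M_def by blast
  define c' where "c' \<alpha> = b mu \<alpha> + (\<Sum>nu\<in>M. c nu * b nu \<alpha>)" for \<alpha>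
  have mon: "monomial_sym n nu x = (\<Sum>\<alpha>\<in>lower_exps n mu. b nu \<alpha> * xmonom n \<alpha> x)"
    if "nu \<in> insert mu M" for nu x
    unfolding b_def using that assms(1)
    by (intro monomial_sym_expand) (auto simp: M_def dominated_def)
  have "P x = (\<Sum>\<alpha>\<in>lower_exps n mu. c' \<alpha> * xmonom n \<alpha> x)" for x
  proof -
    have "(\<Sum>nu\<in>M. c nu * monomial_sym n nu x)
        = (\<Sum>nu\<in>M. \<Sum>\<alpha>\<in>lower_exps n mu. c nu * b nu \<alpha> * xmonom n \<alpha> x)"
      by (intro sum.cong refl) (simp add: mon sum_distrib_left mult.assoc)
    also have "\<dots> = (\<Sum>\<alpha>\<in>lower_exps n mu. (\<Sum>nu\<in>M. c nu * b nu \<alpha>) * xmonom n \<alpha> x)"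
      by (subst sum.swap) (simp add: sum_distrib_right)
    finally show ?thesis
      by (simp add: P c'_def mon distrib_right sum.distrib)
  qed
  moreover have "c' mu = 1"
  proof -
    have "\<exists>\<sigma>. \<sigma> permutes {1..n} \<and> mu = mu \<circ> \<sigma>"
      by (rule exI[of _ id]) (simp add: permutes_id)
    then have "b mu mu = 1" by (simp add: b_def)
    \<comment> \<open>If \<open>mu\<close> were a rearrangement of \<open>nu\<close>, each would lie
      among the exponents below the other, so each would have strictly smaller weight
      \<open>wt n 2\<close> than the other.\<close>
    moreover have "b nu mu = 0" if "nu \<in> M" for nu
    proof (rule ccontr)
      assume "b nu mu \<noteq> 0"
      then obtain \<sigma> where \<sigma>: "\<sigma> permutes {1..n}" "mu = nu \<circ> \<sigma>" unfolding b_def by auto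
      have nu: "is_partition n nu" "dominated n nu mu" "nu \<noteq> mu" using that by (auto simp: M_def)
      then have "nu \<in> lower_exps n mu" by (auto simp: lower_exps_def is_partition_def)
      then have "wt n 2 nu < wt n 2 mu"
        using wt_less_of_dominated[OF _ partition_in_lower_exps[OF assms(1)]] nu by simp
      moreover have "mu \<in> lower_exps n nu"
        using rearrangement_in_lower_exps[OF nu(1) _ \<sigma>(1)] \<sigma>(2) by (auto simp: dominated_def)
      then have "wt n 2 mu < wt n 2 nu"
        using wt_less_of_dominated[OF _ partition_in_lower_exps[OF nu(1)]] nu by auto
      ultimately show False by simp
    qed
    ultimately show ?thesis by (simp add: c'_def)
  qed
  ultimately show thesis by (intro that[of c'] ext)
qed

section \<open>Leading behaviour along a curve\<close>

text \<open>
  Along this curve \<open>x\<^sub>1 \<gg> \<dots> \<gg> x\<^sub>n\<close> as \<open>t \<rightarrow> \<infinity>\<close>, so \<open>x\<^sup>\<mu>\<close> outgrows every monomial that it dominates.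
  For large \<open>B\<close> distinct partitions even have distinct growth orders, because \<open>wt n B\<close> reads
  the parts as digits in base \<open>B\<close>.
\<close>

definition curve :: "nat \<Rightarrow> nat \<Rightarrow> real \<Rightarrow> nat \<Rightarrow> real" where
  "curve n B t = (\<lambda>i. t ^ (B ^ (n - i)))"

lemma xmonom_curve: "xmonom n \<alpha> (curve n B t) = t ^ wt n B \<alpha>"
  by (simp add: xmonom_def curve_def wt_def power_mult[symmetric] power_sum)

text \<open>Eigenvalue equations are available only at points with distinct coordinates; for t > 1
  the curve consists of such points.\<close>

lemma inj_on_curve:
  assumes "2 \<le> B" "1 < t"
  shows "inj_on (curve n B t) {1..n}"
proof (rule inj_onI)
  fix i j assume "i \<in> {1..n}" "j \<in> {1..n}" "curve n B t i = curve n B t j"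
  then have "B ^ (n - i) = B ^ (n - j)" using assms by (simp add: curve_def)
  then have "n - i = n - j" using assms by simp
  then show "i = j" using \<open>i \<in> {1..n}\<close> \<open>j \<in> {1..n}\<close> by auto
qed

lemma power_ratio_tendsto:
  assumes "k \<le> N"
  shows "((\<lambda>t::real. t ^ k / t ^ N) \<longlongrightarrow> of_bool (k = N)) at_top"
proof (cases "k = N")
  case True
  then show ?thesis
    by (auto intro!: tendsto_eventually eventually_mono[OF eventually_gt_at_top[of 0]])
next
  case False
  then have "((\<lambda>t::real. inverse (t ^ (N - k))) \<longlongrightarrow> 0) at_top"
    using assms
    by (intro tendsto_inverse_0_at_top filterlim_pow_at_top filterlim_ident) auto
  moreover have "\<forall>\<^sub>F t::real in at_top. inverse (t ^ (N - k)) = t ^ k / t ^ N"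
    using eventually_gt_at_top[of 0]
    by eventually_elim (use assms in \<open>simp add: power_diff field_simps\<close>)
  ultimately have "((\<lambda>t::real. t ^ k / t ^ N) \<longlongrightarrow> 0) at_top"
    by (rule Lim_transform_eventually)
  then show ?thesis using False by simp
qed

text \<open>Every exponent other than \<open>mu\<close> has strictly smaller weight, so only x^\<mu>
  can survive the division by t^N. N may exceed the weight of \<open>mu\<close>, so that several
  partitions can be normalised by one common power.\<close>

lemma lower_exps_tendsto:
  assumes "2 \<le> B" "is_partition n mu" "wt n B mu \<le> N"
  shows "((\<lambda>t. (\<Sum>\<alpha>\<in>lower_exps n mu. g \<alpha> * xmonom n \<alpha> (curve n B t)) / t ^ N)
    \<longlongrightarrow> of_bool (wt n B mu = N) * g mu) at_top"
proof -
  have mu: "mu \<in> lower_exps n mu" by (rule partition_in_lower_exps[OF assms(2)])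
  have le: "wt n B \<alpha> \<le> N" if "\<alpha> \<in> lower_exps n mu" for \<alpha>
    using wt_less_of_dominated[OF assms(1) mu that] assms(3) by (cases "\<alpha> = mu") auto
  have "((\<lambda>t. \<Sum>\<alpha>\<in>lower_exps n mu. g \<alpha> * (t ^ wt n B \<alpha> / t ^ N))
    \<longlongrightarrow> (\<Sum>\<alpha>\<in>lower_exps n mu. g \<alpha> * of_bool (wt n B \<alpha> = N))) at_top"
    by (intro tendsto_sum tendsto_mult tendsto_const power_ratio_tendsto le)
  also have "(\<Sum>\<alpha>\<in>lower_exps n mu. g \<alpha> * of_bool (wt n B \<alpha> = N))
      = (\<Sum>\<alpha>\<in>lower_exps n mu. if mu = \<alpha> then of_bool (wt n B mu = N) * g mu else 0)"
    using wt_less_of_dominated[OF assms(1) mu] assms(3) by (intro sum.cong refl) fastforce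
  also have "\<dots> = of_bool (wt n B mu = N) * g mu"
    using mu by (simp add: finite_lower_exps)
  finally show ?thesis
    by (simp add: sum_divide_distrib xmonom_curve)
qed

text \<open>x_i outgrows x_j exactly when i < j. Counting the j > i is the origin of the factor n -
  i in d_\<lambda>.\<close>

lemma curve_coefficient_tendsto:
  assumes "2 \<le> B" "i \<in> {1..n}" "j \<in> {1..n}" "i \<noteq> j"
  shows "((\<lambda>t. curve n B t i / (curve n B t i - curve n B t j)) \<longlongrightarrow> of_bool (i < j)) at_top"
proof -
  define p q where "p = B ^ (n - i)" and "q = B ^ (n - j)"
  have powers: "curve n B t i = t ^ p" "curve n B t j = t ^ q" for t
    by (simp_all add: curve_def p_def q_def)
  show ?thesis
  proof (cases "i < j")
    case True
    then have "q < p" using assms unfolding p_def q_def by (intro power_strict_increasing) auto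
    then have "((\<lambda>t::real. 1 / (1 - t ^ q / t ^ p)) \<longlongrightarrow> 1 / (1 - of_bool (q = p))) at_top"
      by (intro tendsto_intros power_ratio_tendsto) auto
    moreover have "\<forall>\<^sub>F t::real in at_top. 1 / (1 - t ^ q / t ^ p) = t ^ p / (t ^ p - t ^ q)"
      using eventually_gt_at_top[of 1] by eventually_elim (use \<open>q < p\<close> in \<open>simp add: field_simps\<close>)
    ultimately have "((\<lambda>t::real. t ^ p / (t ^ p - t ^ q)) \<longlongrightarrow> 1 / (1 - of_bool (q = p))) at_top"
      by (rule Lim_transform_eventually)
    then show ?thesis unfolding powers using True \<open>q < p\<close> by simp
  next
    case False
    then have "p < q" using assms unfolding p_def q_def by (intro power_strict_increasing) auto
    then have "((\<lambda>t::real. (t ^ p / t ^ q) / (t ^ p / t ^ q - 1))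
        \<longlongrightarrow> of_bool (p = q) / (of_bool (p = q) - 1)) at_top"
      by (intro tendsto_intros power_ratio_tendsto) auto
    moreover have "\<forall>\<^sub>F t::real in at_top.
        (t ^ p / t ^ q) / (t ^ p / t ^ q - 1) = t ^ p / (t ^ p - t ^ q)"
      using eventually_gt_at_top[of 1] by eventually_elim (use \<open>p < q\<close> in \<open>simp add: field_simps\<close>)
    ultimately have "((\<lambda>t::real. t ^ p / (t ^ p - t ^ q)) \<longlongrightarrow> of_bool (p = q) / (of_bool (p = q) - 1))
        at_top"
      by (rule Lim_transform_eventually)
    then show ?thesis unfolding powers using False \<open>p < q\<close> by simp
  qed
qed

section \<open>The differential operators on Jack polynomials\<close>

lemma polyfun_jack:
  assumes "is_partition n mu" "is_jack n \<kappa> mu P"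
  shows "polyfun n P"
proof -
  obtain c where P: "P = (\<lambda>x. \<Sum>\<alpha>\<in>lower_exps n mu. c \<alpha> * xmonom n \<alpha> x)"
    using is_jack_expansion[OF assms] by metis
  show ?thesis unfolding P by (intro polyfun_sum polyfun.monom)
qed

text \<open>Dominance fixes the weight, so all monomials of P_\<mu> have the same degree and the
  Euler identity sums to that degree.\<close>

lemma op_E1_jack:
  assumes "is_partition n mu" "is_jack n \<kappa> mu P"
  shows "op_E1 n P x = real (weight n mu) * P x"
proof -
  obtain c where P: "P = (\<lambda>x. \<Sum>\<alpha>\<in>lower_exps n mu. c \<alpha> * xmonom n \<alpha> x)"
    using is_jack_expansion[OF assms] by metis
  have "op_E1 n P x
      = (\<Sum>i=1..n. \<Sum>\<alpha>\<in>lower_exps n mu. c \<alpha> * (real (\<alpha> i) * xmonom n \<alpha> x))"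
    unfolding op_E1_def
    by (intro sum.cong refl)
      (simp add: P partial_sum[OF polyfun_monom] sum_distrib_left euler_monom[symmetric] mult_ac)
  also have "\<dots> = (\<Sum>\<alpha>\<in>lower_exps n mu. c \<alpha> * (real (weight n \<alpha>) * xmonom n \<alpha> x))"
    by (subst sum.swap) (simp add: weight_def sum_distrib_left sum_distrib_right)
  also have "\<dots> = (\<Sum>\<alpha>\<in>lower_exps n mu. real (weight n mu) * (c \<alpha> * xmonom n \<alpha> x))"
    by (intro sum.cong refl) (auto simp: lower_exps_def dominated_def)
  finally show ?thesis by (simp add: P sum_distrib_left)
qed

lemma jack_homogeneous:
  assumes "is_partition n mu" "is_jack n \<kappa> mu P"
  shows "P (\<lambda>i. s * x i) = s ^ weight n mu * P x"
proof -
  obtain c where P: "P = (\<lambda>x. \<Sum>\<alpha>\<in>lower_exps n mu. c \<alpha> * xmonom n \<alpha> x)"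
    using is_jack_expansion[OF assms] by metis
  have "xmonom n \<alpha> (\<lambda>i. s * x i) = s ^ weight n mu * xmonom n \<alpha> x" if "\<alpha> \<in> lower_exps n mu" for \<alpha>
  proof -
    have "weight n \<alpha> = weight n mu" using that by (simp add: lower_exps_def dominated_def)
    then show ?thesis
      by (simp add: xmonom_def power_mult_distrib prod.distrib power_sum[symmetric] weight_def)
  qed
  then show ?thesis by (simp add: P sum_distrib_left mult_ac)
qed

lemma jack_curve_tendsto:
  assumes "2 \<le> B" "is_partition n mu" "is_jack n \<kappa> mu P" "wt n B mu \<le> N"
  shows "((\<lambda>t. P (curve n B t) / t ^ N) \<longlongrightarrow> of_bool (wt n B mu = N)) at_top"
proof -
  obtain c where c: "c mu = 1" and P: "P = (\<lambda>x. \<Sum>\<alpha>\<in>lower_exps n mu. c \<alpha> * xmonom n \<alpha> x)"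
    using is_jack_expansion[OF assms(2,3)] by metis
  show ?thesis using lower_exps_tendsto[OF assms(1,2,4), of c] by (simp add: P c)
qed

text \<open>The eigenvalue is read off from the leading terms of both sides along the curve.\<close>

lemma op_D2_jack:
  assumes "is_partition n mu" "is_jack n \<kappa> mu P" "inj_on x {1..n}"
  shows "op_D2 n \<kappa> P x = eigval_d n \<kappa> mu * P x"
proof -
  \<comment> \<open>Base 2 suffices for a single Jack polynomial, where the weight only has to
    respect dominance.\<close>
  let ?L = "lower_exps n mu" and ?X = "curve n 2" and ?N = "wt n 2 mu"
  obtain c where c: "c mu = 1" and P: "P = (\<lambda>x. \<Sum>\<alpha>\<in>?L. c \<alpha> * xmonom n \<alpha> x)"
    using is_jack_expansion[OF assms(1,2)] by metis
  have "eigenfunction n (op_D2 n \<kappa>) P" using assms(2) by (simp add: is_jack_def)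
  then obtain E where E: "\<And>x. inj_on x {1..n} \<Longrightarrow> op_D2 n \<kappa> P x = E * P x"
    unfolding eigenfunction_def by metis
  have p1: "x i * partial i P x = (\<Sum>\<alpha>\<in>?L. c \<alpha> * real (\<alpha> i) * xmonom n \<alpha> x)"
    if "i \<in> {1..n}" for x i
  proof -
    have "x i * partial i P x = (\<Sum>\<alpha>\<in>?L. c \<alpha> * (x i * partial i (xmonom n \<alpha>) x))"
      unfolding P partial_sum[OF polyfun_monom that]
      by (simp add: sum_distrib_left mult.left_commute)
    then show ?thesis by (simp only: euler_monom[OF that] mult.assoc)
  qed
  have p2: "(x i)\<^sup>2 * partial i (partial i P) x
      = (\<Sum>\<alpha>\<in>?L. c \<alpha> * (real (\<alpha> i) * (real (\<alpha> i) - 1)) * xmonom n \<alpha> x)"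
    if "i \<in> {1..n}" for x i
  proof -
    have "(x i)\<^sup>2 * partial i (partial i P) x
        = (\<Sum>\<alpha>\<in>?L. c \<alpha> * ((x i)\<^sup>2 * partial i (partial i (xmonom n \<alpha>)) x))"
      unfolding P partial2_sum[OF polyfun_monom that]
      by (simp add: sum_distrib_left mult.left_commute)
    then show ?thesis by (simp only: euler2_monom[OF that] mult.assoc)
  qed
  let ?A = "\<lambda>t i. \<Sum>\<alpha>\<in>?L. c \<alpha> * real (\<alpha> i) * xmonom n \<alpha> (?X t)"
  let ?Q = "\<lambda>t i. \<Sum>\<alpha>\<in>?L. c \<alpha> * (real (\<alpha> i) * (real (\<alpha> i) - 1)) * xmonom n \<alpha> (?X t)"
  \<comment> \<open>One factor of x_i^2 is spent on the Euler form of the derivative; with the other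
    one left, the singular coefficient has a finite limit along the curve.\<close>
  let ?R = "\<lambda>t i j. ?X t i / (?X t i - ?X t j)"
  have fraction: "((\<Sum>i=1..n. q i) + 2 * \<kappa> * (\<Sum>i=1..n. \<Sum>j\<in>{1..n}-{i}. r i j * b i)) / T
      = (\<Sum>i=1..n. q i / T) + 2 * \<kappa> * (\<Sum>i=1..n. \<Sum>j\<in>{1..n}-{i}. r i j * (b i / T))"
    for q b :: "nat \<Rightarrow> real" and r T
    by (simp add: add_divide_distrib sum_divide_distrib sum_distrib_left)
  have D2: "op_D2 n \<kappa> P (?X t) / t ^ ?N = (\<Sum>i=1..n. ?Q t i / t ^ ?N)
      + 2 * \<kappa> * (\<Sum>i=1..n. \<Sum>j\<in>{1..n}-{i}. ?R t i j * (?A t i / t ^ ?N))" for t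
  proof -
    have "(\<Sum>i=1..n. \<Sum>j\<in>{1..n}-{i}. (?X t i)\<^sup>2 / (?X t i - ?X t j) * partial i P (?X t))
        = (\<Sum>i=1..n. \<Sum>j\<in>{1..n}-{i}. ?R t i j * ?A t i)"
      by (intro sum.cong refl) (simp add: p1[symmetric] power2_eq_square)
    moreover have "(\<Sum>i=1..n. (?X t i)\<^sup>2 * partial i (partial i P) (?X t)) = (\<Sum>i=1..n. ?Q t i)"
      by (intro sum.cong refl p2)
    ultimately show ?thesis
      unfolding op_D2_def by (simp only: fraction)
  qed
  have lim_A: "((\<lambda>t. ?A t i / t ^ ?N) \<longlongrightarrow> of_bool (?N = ?N) * (c mu * real (mu i))) at_top" for i
    by (rule lower_exps_tendsto) (use assms in auto)
  have lim_Q: "((\<lambda>t. ?Q t i / t ^ ?N)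
      \<longlongrightarrow> of_bool (?N = ?N) * (c mu * (real (mu i) * (real (mu i) - 1)))) at_top" for i
    by (rule lower_exps_tendsto) (use assms in auto)
  have "((\<lambda>t. op_D2 n \<kappa> P (?X t) / t ^ ?N) \<longlongrightarrow>
      (\<Sum>i=1..n. of_bool (?N = ?N) * (c mu * (real (mu i) * (real (mu i) - 1))))
      + 2 * \<kappa> * (\<Sum>i=1..n. \<Sum>j\<in>{1..n}-{i}.
          of_bool (i < j) * (of_bool (?N = ?N) * (c mu * real (mu i))))) at_top"
    unfolding D2
    by (intro tendsto_add tendsto_mult tendsto_sum tendsto_const lim_A lim_Q
        curve_coefficient_tendsto) auto
  also have "(\<Sum>i=1..n. of_bool (?N = ?N) * (c mu * (real (mu i) * (real (mu i) - 1))))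
      + 2 * \<kappa> * (\<Sum>i=1..n. \<Sum>j\<in>{1..n}-{i}.
          of_bool (i < j) * (of_bool (?N = ?N) * (c mu * real (mu i)))) = eigval_d n \<kappa> mu"
  proof -
    have inner: "(\<Sum>j\<in>{1..n}-{i}. of_bool (i < j) * real (mu i)) = (real n - real i) * real (mu i)"
      if "i \<in> {1..n}" for i
    proof -
      have "(\<Sum>j\<in>{1..n}-{i}. of_bool (i < j) * real (mu i)) = (\<Sum>j\<in>{i<..n}. real (mu i))"
        by (rule sum.mono_neutral_cong_right) (use that in auto)
      also have "\<dots> = (real n - real i) * real (mu i)" using that by (simp add: of_nat_diff)
      finally show ?thesis .
    qed
    have "(\<Sum>i=1..n. \<Sum>j\<in>{1..n}-{i}.
          of_bool (i < j) * (of_bool (?N = ?N) * (c mu * real (mu i))))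
        = (\<Sum>i=1..n. (real n - real i) * real (mu i))"
      by (intro sum.cong refl) (simp only: c simp_thms of_bool_eq mult_1_left inner)
    then show ?thesis
      by (simp add: c eigval_d_def sum_distrib_left sum.distrib[symmetric] distrib_left mult_ac)
  qed
  finally have "((\<lambda>t. op_D2 n \<kappa> P (?X t) / t ^ ?N) \<longlongrightarrow> eigval_d n \<kappa> mu) at_top" .
  \<comment> \<open>The same limit computed from the eigenvalue equation, which applies for t >
    1.\<close>
  moreover have "((\<lambda>t. op_D2 n \<kappa> P (?X t) / t ^ ?N) \<longlongrightarrow> E * of_bool (?N = ?N)) at_top"
  proof (rule Lim_transform_eventually)
    show "((\<lambda>t. E * (P (?X t) / t ^ ?N)) \<longlongrightarrow> E * of_bool (?N = ?N)) at_top"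
      by (intro tendsto_mult tendsto_const jack_curve_tendsto[OF _ assms(1,2)]) auto
    show "\<forall>\<^sub>F t in at_top. E * (P (?X t) / t ^ ?N) = op_D2 n \<kappa> P (?X t) / t ^ ?N"
      using eventually_gt_at_top[of 1] by eventually_elim (simp add: E[OF inj_on_curve])
  qed
  ultimately have "eigval_d n \<kappa> mu = E * of_bool (?N = ?N)"
    by (rule tendsto_unique[OF trivial_limit_at_top_linorder])
  then show ?thesis using E assms(3) by simp
qed

text \<open>Dominance is only a partial order and cannot single out a leading term among several
  partitions. With B beyond all parts, \<open>wt n B\<close> separates them: dividing by the highest
  power of t that occurs with nonzero coefficient leaves exactly that coefficient in the
  limit.\<close>

lemma jack_independent:
  assumes "finite F" "\<And>mu. mu \<in> F \<Longrightarrow> is_partition n mu \<and> is_jack n \<kappa> mu (P mu)"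
    and zero: "\<And>x. inj_on x {1..n} \<Longrightarrow> (\<Sum>mu\<in>F. v mu * P mu x) = 0"
    and "mu \<in> F"
  shows "v mu = 0"
proof (rule ccontr)
  assume "v mu \<noteq> 0"
  define G where "G = {nu \<in> F. v nu \<noteq> 0}"
  have G: "finite G" "G \<noteq> {}" using \<open>v mu \<noteq> 0\<close> assms(1,4) by (auto simp: G_def)
  \<comment> \<open>Larger than every part, so that parts are digits in base B; the second
    \<open>Suc\<close> secures \<open>2 \<le> B\<close> even when all parts are 0.\<close>
  define B where "B = Suc (Suc (Max ((\<lambda>(nu, i). nu i) ` (F \<times> {1..n}))))"
  have B: "nu i < B" if "nu \<in> F" "i \<in> {1..n}" for nu i
  proof -
    have "nu i \<le> Max ((\<lambda>(nu, i). nu i) ` (F \<times> {1..n}))"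
      using that assms(1) by (intro Max_ge) (auto intro: rev_image_eqI)
    then show ?thesis by (simp add: B_def)
  qed
  have B2: "2 \<le> B" by (simp add: B_def)
  define N where "N = Max (wt n B ` G)"
  have "N \<in> wt n B ` G" unfolding N_def using G by (intro Max_in) auto
  then obtain top where top: "top \<in> G" "wt n B top = N" by auto
  have le: "wt n B nu \<le> N" if "nu \<in> G" for nu
    using G that by (simp add: N_def)
  have eq_top: "wt n B nu = N \<longleftrightarrow> nu = top" if "nu \<in> G" for nu
  proof
    assume "wt n B nu = N"
    then have "\<forall>i\<in>{1..n}. nu i = top i"
      using that top B by (intro wt_inj[where B=B]) (auto simp: G_def)
    moreover have "nu i = top i" if "i \<notin> {1..n}" for i
    proof -
      have "is_partition n nu" "is_partition n top"
        using \<open>nu \<in> G\<close> \<open>top \<in> G\<close> assms(2) by (auto simp: G_def)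
      then show ?thesis using that unfolding is_partition_def by metis
    qed
    ultimately show "nu = top" by blast
  qed (use top in simp)
  have vanish: "(\<Sum>nu\<in>G. v nu * (P nu (curve n B t) / t ^ N)) = 0" if "1 < t" for t
  proof -
    have "(\<Sum>nu\<in>G. v nu * P nu (curve n B t)) = (\<Sum>nu\<in>F. v nu * P nu (curve n B t))"
      unfolding G_def by (rule sum.mono_neutral_cong_left) (use assms(1) in auto)
    also have "\<dots> = 0" by (rule zero[OF inj_on_curve[OF B2 that]])
    finally show ?thesis by (simp add: sum_divide_distrib[symmetric])
  qed
  have "((\<lambda>t. \<Sum>nu\<in>G. v nu * (P nu (curve n B t) / t ^ N))
      \<longlongrightarrow> (\<Sum>nu\<in>G. v nu * of_bool (wt n B nu = N))) at_top"
    using B2 le assms(2)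
    by (intro tendsto_sum tendsto_mult tendsto_const jack_curve_tendsto) (auto simp: G_def)
  also have "(\<Sum>nu\<in>G. v nu * of_bool (wt n B nu = N)) = (\<Sum>nu\<in>G. if top = nu then v top else 0)"
    by (intro sum.cong refl) (auto simp: eq_top)
  also have "\<dots> = v top" using G top by simp
  finally have "((\<lambda>t. \<Sum>nu\<in>G. v nu * (P nu (curve n B t) / t ^ N)) \<longlongrightarrow> v top) at_top" .
  moreover have "((\<lambda>t. \<Sum>nu\<in>G. v nu * (P nu (curve n B t) / t ^ N)) \<longlongrightarrow> 0) at_top"
    by (rule tendsto_eventually)
      (use eventually_gt_at_top[of 1] in eventually_elim, rule vanish)
  ultimately have "v top = 0"
    by (rule tendsto_unique[OF trivial_limit_at_top_linorder])
  then show False using top by (simp add: G_def)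
qed

section \<open>Partitions below a given one, and the lowering of Jack polynomials by one box\<close>

lemma weight_mono: "mu \<le> lam \<Longrightarrow> weight n mu \<le> weight n lam"
  unfolding weight_def by (intro sum_mono) (auto dest: le_funD)

lemma finite_partitions_below: "finite {mu. is_partition n mu \<and> mu \<le> lam}"
proof (rule finite_subset[OF _ finite_bounded_exps[of n "weight n lam"]], safe)
  fix mu i assume "mu \<le> lam" "i \<in> {1..n}"
  moreover have "lam i \<le> weight n lam"
    unfolding weight_def using \<open>i \<in> {1..n}\<close> by (intro member_le_sum) auto
  ultimately show "mu i \<le> weight n lam" using le_funD order_trans by metis
qed (auto simp: is_partition_def)

text \<open>
  Homogeneity turns the unit shift in the defining relation of the binomial coefficients into
  a shift by an arbitrary \<open>s\<close>; the claim is the term of first order in \<open>s\<close>.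
\<close>

lemma sum_partial_jack:
  assumes mu: "is_partition n mu"
    and J: "\<And>nu. is_partition n nu \<Longrightarrow> nu \<le> mu \<Longrightarrow> is_jack n \<kappa> nu (jack n \<kappa> nu)"
    and nz: "jack_at_one n \<kappa> mu \<noteq> 0"
    and b: "gen_binomials n \<kappa> mu b"
  shows "(\<Sum>i=1..n. partial i (jack n \<kappa> mu) x) =
    (\<Sum>nu | is_partition n nu \<and> nu \<le> mu \<and> weight n mu = Suc (weight n nu).
      jack_at_one n \<kappa> mu / jack_at_one n \<kappa> nu * b nu * jack n \<kappa> nu x)"
proof -
  define F where "F = {nu. is_partition n nu \<and> nu \<le> mu}"
  define P where "P = jack n \<kappa>"
  define k where "k nu = jack_at_one n \<kappa> mu / jack_at_one n \<kappa> nu * b nu" for nu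
  define q where "q s = (\<Sum>nu\<in>F. k nu * P nu x * s ^ (weight n mu - weight n nu))" for s
  have finF: "finite F" unfolding F_def by (rule finite_partitions_below)
  have PJ: "is_partition n nu" "is_jack n \<kappa> nu (P nu)" if "nu \<in> F" for nu
    using J that by (auto simp: F_def P_def)
  have mu_F: "mu \<in> F" using mu by (simp add: F_def)
  have shift: "P mu (\<lambda>i. y i + 1) = (\<Sum>nu\<in>F. k nu * P nu y)" for y
  proof -
    have "P mu (\<lambda>i. y i + 1) = jack_at_one n \<kappa> mu *
        (\<Sum>nu\<in>F. b nu * (P nu y / jack_at_one n \<kappa> nu))"
      using b nz by (simp add: gen_binomials_def P_def F_def field_simps)
    then show ?thesis by (simp add: sum_distrib_left k_def mult_ac)
  qed
  \<comment> \<open>Write x + s as s (x/s + 1), apply the unit shift at x/s, and let homogeneity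
    collect the powers of s. The exponent in \<open>q\<close> is an exact difference because \<nu>
    is contained in \<mu>.\<close>
  have P_q: "P mu (\<lambda>i. x i + s) = q s" if "s \<noteq> 0" for s
  proof -
    have "P mu (\<lambda>i. x i + s) = P mu (\<lambda>i. s * (inverse s * x i + 1))"
      using that by (simp add: distrib_left mult.assoc[symmetric])
    also have "\<dots> = s ^ weight n mu * (\<Sum>nu\<in>F. k nu * P nu (\<lambda>i. inverse s * x i))"
      by (simp only: jack_homogeneous[OF PJ[OF mu_F]] shift)
    also have "\<dots> = (\<Sum>nu\<in>F. k nu * P nu x * (s ^ weight n mu * inverse s ^ weight n nu))"
      by (simp add: sum_distrib_left jack_homogeneous[OF PJ] mult_ac)
    also have "\<dots> = q s"
      unfolding q_def
    proof (intro sum.cong refl)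
      fix nu assume "nu \<in> F"
      then have "weight n nu \<le> weight n mu" by (simp add: F_def weight_mono)
      then show "k nu * P nu x * (s ^ weight n mu * inverse s ^ weight n nu)
          = k nu * P nu x * s ^ (weight n mu - weight n nu)"
        using that by (simp add: power_diff divide_inverse power_inverse)
    qed
    finally show ?thesis .
  qed
  have D_P: "((\<lambda>s. P mu (\<lambda>i. x i + s)) has_real_derivative (\<Sum>i=1..n. partial i (P mu) x)) (at 0)"
    by (rule DERIV_diagonal[OF polyfun_jack[OF PJ[OF mu_F]]])
  have D_q: "(q has_real_derivative
      (\<Sum>nu\<in>F. k nu * P nu x * of_bool (weight n mu - weight n nu = 1))) (at 0)"
  proof -
    have "((\<lambda>s::real. s ^ m) has_real_derivative of_bool (m = 1)) (at 0)" for m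
    proof -
      have "real m * 0 ^ (m - Suc 0) = of_bool (m = 1)"
        by (cases "m = 0 \<or> m = 1") (auto simp: power_0_left)
      then show ?thesis using DERIV_pow[of m "0::real"] by simp
    qed
    then show ?thesis
      unfolding q_def by (intro DERIV_sum DERIV_cmult)
  qed
  \<comment> \<open>The identity was obtained by dividing by s; continuity of both sides extends it
    to s = 0, the point at which the derivatives are compared.\<close>
  have "P mu (\<lambda>i. x i + 0) = q 0"
  proof (rule tendsto_unique)
    show "((\<lambda>s. P mu (\<lambda>i. x i + s)) \<longlongrightarrow> P mu (\<lambda>i. x i + 0)) (at 0)"
      using DERIV_isCont[OF D_P] by (simp add: isCont_def)
    have "(q \<longlongrightarrow> q 0) (at 0)" using DERIV_isCont[OF D_q] by (simp add: isCont_def)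
    then show "((\<lambda>s. P mu (\<lambda>i. x i + s)) \<longlongrightarrow> q 0) (at 0)"
      by (rule Lim_transform_eventually) (auto simp: eventually_at_filter P_q)
  qed simp
  then have "P mu (\<lambda>i. x i + s) = q s" for s
    using P_q by (cases "s = 0") simp_all
  then have "(\<lambda>s. P mu (\<lambda>i. x i + s)) = q" by (rule ext)
  then have "(\<Sum>i=1..n. partial i (P mu) x) =
      (\<Sum>nu\<in>F. k nu * P nu x * of_bool (weight n mu - weight n nu = 1))"
    by (intro DERIV_unique[OF _ D_q]) (use D_P in simp)
  also have "\<dots> = (\<Sum>nu | is_partition n nu \<and> nu \<le> mu \<and> weight n mu = Suc (weight n nu).
      k nu * P nu x)"
    by (rule sum.mono_neutral_cong_right) (use finF in \<open>auto simp: F_def\<close>)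
  finally show ?thesis unfolding P_def k_def .
qed

lemma op_DB_jack:
  assumes mu: "is_partition n mu"
    and J: "\<And>nu. is_partition n nu \<Longrightarrow> nu \<le> mu \<Longrightarrow> is_jack n \<kappa> nu (jack n \<kappa> nu)"
    and nz: "jack_at_one n \<kappa> mu \<noteq> 0"
    and b: "gen_binomials n \<kappa> mu b"
    and x: "inj_on x {1..n}"
  shows "op_DB n a \<kappa> (jack n \<kappa> mu) x = eigval_e n a \<kappa> mu * jack n \<kappa> mu x +
    2 * (\<Sum>nu | is_partition n nu \<and> nu \<le> mu \<and> weight n mu = Suc (weight n nu).
      jack_at_one n \<kappa> mu / jack_at_one n \<kappa> nu * b nu * jack n \<kappa> nu x)"
proof -
  have shift: "(\<Sum>i=1..n. partial i (jack n \<kappa> mu) x) =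
      (\<Sum>nu | is_partition n nu \<and> nu \<le> mu \<and> weight n mu = Suc (weight n nu).
        jack_at_one n \<kappa> mu / jack_at_one n \<kappa> nu * b nu * jack n \<kappa> nu x)"
    by (rule sum_partial_jack[OF mu _ nz b]) (rule J)
  show ?thesis
    unfolding op_DB_decompose shift op_D2_jack[OF mu J[OF mu order_refl] x]
      op_E1_jack[OF mu J[OF mu order_refl]] eigval_e_def
    by (simp add: algebra_simps)
qed

section \<open>Standard tableaux\<close>

lemma weight_less:
  assumes "is_partition n lam" "mu < lam"
  shows "weight n mu < weight n lam"
proof -
  obtain i where i: "mu i < lam i"
    using assms(2) by (metis le_funI less_le_not_le linorder_not_less)
  then have "i \<in> {1..n}" using assms(1) by (force simp: is_partition_def)
  then show ?thesis
    unfolding weight_def using i assms(2)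
    by (intro sum_strict_mono_ex1) (auto simp: less_fun_def le_fun_def)
qed

lemma std_tableaux_self:
  assumes "is_partition n lam"
  shows "std_tableaux n lam lam = {[lam]}"
  using assms by (auto simp: std_tableaux_def length_Suc_conv)

lemma tableau_le_head:
  assumes "T \<in> std_tableaux n lam mu" "i \<le> weight n lam - weight n mu"
  shows "T ! i \<le> lam"
  using assms(2)
proof (induction i)
  case 0
  then show ?case using assms(1) by (simp add: std_tableaux_def)
next
  case (Suc i)
  have "T ! Suc i < T ! i"
    using assms(1) Suc.prems by (auto simp: std_tableaux_def dest!: bspec[of _ _ "Suc i"])
  then show ?case using Suc by simp
qed

lemma finite_std_tableaux: "finite (std_tableaux n lam mu)"
proof (rule finite_subset)
  show "finite {T. set T \<subseteq> {nu. is_partition n nu \<and> nu \<le> lam} \<and>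
      length T = weight n lam - weight n mu + 1}"
    by (rule finite_lists_length_eq[OF finite_partitions_below])
  show "std_tableaux n lam mu \<subseteq> \<dots>"
  proof
    fix T assume T: "T \<in> std_tableaux n lam mu"
    have len: "length T = weight n lam - weight n mu + 1"
      and part: "\<forall>nu\<in>set T. is_partition n nu"
      using T by (simp_all add: std_tableaux_def)
    have "nu \<le> lam" if nu: "nu \<in> set T" for nu
    proof -
      obtain i where i: "i < length T" "nu = T ! i"
        using nu by (auto simp: in_set_conv_nth)
      have "i \<le> weight n lam - weight n mu" using i(1) len by simp
      from tableau_le_head[OF T this] show ?thesis using i(2) by simp
    qed
    with len part show "T \<in> {T. set T \<subseteq> {nu. is_partition n nu \<and> nu \<le> lam} \<and>
        length T = weight n lam - weight n mu + 1}"
      by blast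
  qed
qed

text \<open>The partition \<mu> is the last entry of the shortened chain. Cutting at the end rather
  than at the head keeps the numbering of the other steps, on which the factors ai + d_\<lambda> - d
  depend, and leaves \<lambda> fixed.\<close>

lemma snoc_in_std_tableaux_iff:
  assumes "is_partition n nu" "Suc (weight n nu) \<le> weight n lam"
  shows "T' @ [nu] \<in> std_tableaux n lam nu \<longleftrightarrow>
    (\<exists>mu. is_partition n mu \<and> mu \<le> lam \<and> nu \<le> mu \<and> weight n mu = Suc (weight n nu) \<and>
      T' \<in> std_tableaux n lam mu)"
proof -
  define m where "m = weight n lam - Suc (weight n nu)"
  have m: "weight n lam - weight n nu = Suc m" using assms(2) by (simp add: m_def)
  show ?thesis
  proof
    assume T: "T' @ [nu] \<in> std_tableaux n lam nu"
    define mu where "mu = T' ! m"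
    have len: "length T' = Suc m" using T m by (simp add: std_tableaux_def)
    have nth: "(T' @ [nu]) ! i = T' ! i" if "i \<le> m" for i
      using that len by (simp add: nth_append)
    have "nu < mu" "weight n mu = Suc (weight n nu)"
      using T len m nth[of m]
      by (auto simp: std_tableaux_def mu_def dest!: bspec[of _ _ "Suc m"])
    moreover have "mu \<le> lam" using tableau_le_head[OF T, of m] m nth[of m] by (simp add: mu_def)
    moreover have "is_partition n mu" using T len by (simp add: std_tableaux_def mu_def)
    moreover have "T' \<in> std_tableaux n lam mu"
      unfolding std_tableaux_def
    proof (intro CollectI conjI ballI)
      have m': "weight n lam - weight n mu = m"
        using \<open>weight n mu = Suc (weight n nu)\<close> by (simp add: m_def)
      show "length T' = weight n lam - weight n mu + 1" using len m' by simp
      show "T' ! 0 = lam" using T nth[of 0] by (simp add: std_tableaux_def)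
      show "T' ! (weight n lam - weight n mu) = mu" by (simp add: m' flip: mu_def)
      show "is_partition n \<rho>" if "\<rho> \<in> set T'" for \<rho>
        using T that by (simp add: std_tableaux_def)
      fix i assume "i \<in> {1..weight n lam - weight n mu}"
      then have "i \<in> {1..Suc m}" "i \<le> m" using m' by auto
      have "(T' @ [nu]) ! i < (T' @ [nu]) ! (i - 1) \<and>
          weight n ((T' @ [nu]) ! (i - 1)) = weight n ((T' @ [nu]) ! i) + 1"
        using T \<open>i \<in> {1..Suc m}\<close> unfolding std_tableaux_def m by blast
      then show "T' ! i < T' ! (i - 1)" "weight n (T' ! (i - 1)) = weight n (T' ! i) + 1"
        using nth[of i] nth[of "i - 1"] \<open>i \<le> m\<close> by auto
    qed
    ultimately show "\<exists>mu. is_partition n mu \<and> mu \<le> lam \<and> nu \<le> mu \<and>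
        weight n mu = Suc (weight n nu) \<and> T' \<in> std_tableaux n lam mu"
      by (auto intro: less_imp_le)
  next
    assume "\<exists>mu. is_partition n mu \<and> mu \<le> lam \<and> nu \<le> mu \<and>
        weight n mu = Suc (weight n nu) \<and> T' \<in> std_tableaux n lam mu"
    then obtain mu where mu: "nu \<le> mu" "weight n mu = Suc (weight n nu)"
      and T': "T' \<in> std_tableaux n lam mu" by blast
    have m': "weight n lam - weight n mu = m" using mu by (simp add: m_def)
    have len: "length T' = Suc m" using T' m' by (simp add: std_tableaux_def)
    have nth: "(T' @ [nu]) ! i = T' ! i" if "i \<le> m" for i
      using that len by (simp add: nth_append)
    have last: "(T' @ [nu]) ! Suc m = nu" using len by (simp add: nth_append)
    have "nu \<noteq> mu" using mu(2) by auto
    then have "nu < mu" using mu(1) by simp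
    show "T' @ [nu] \<in> std_tableaux n lam nu"
      unfolding std_tableaux_def m
    proof (intro CollectI conjI ballI)
      show "length (T' @ [nu]) = Suc m + 1" using len by simp
      show "(T' @ [nu]) ! 0 = lam" using T' nth[of 0] by (simp add: std_tableaux_def)
      show "(T' @ [nu]) ! Suc m = nu" by (rule last)
      show "is_partition n \<rho>" if "\<rho> \<in> set (T' @ [nu])" for \<rho>
        using T' that assms(1) by (auto simp: std_tableaux_def)
      fix i assume i: "i \<in> {1..Suc m}"
      have T'm: "T' ! m = mu" using T' m' by (simp add: std_tableaux_def)
      have "(T' @ [nu]) ! i < (T' @ [nu]) ! (i - 1) \<and>
          weight n ((T' @ [nu]) ! (i - 1)) = weight n ((T' @ [nu]) ! i) + 1"
      proof (cases "i = Suc m")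
        case True
        then show ?thesis using last nth[of m] T'm \<open>nu < mu\<close> mu by simp
      next
        case False
        then have "i \<le> m" "i - 1 \<le> m" using i by auto
        then show ?thesis using T' i m' nth by (simp add: std_tableaux_def)
      qed
      then show "(T' @ [nu]) ! i < (T' @ [nu]) ! (i - 1)"
        "weight n ((T' @ [nu]) ! (i - 1)) = weight n ((T' @ [nu]) ! i) + 1" by auto
    qed
  qed
qed

lemma std_tableaux_step:
  assumes "is_partition n nu" "Suc (weight n nu) \<le> weight n lam"
  shows "std_tableaux n lam nu =
    (\<Union>mu\<in>{mu. is_partition n mu \<and> mu \<le> lam \<and> nu \<le> mu \<and> weight n mu = Suc (weight n nu)}.
      (\<lambda>T. T @ [nu]) ` std_tableaux n lam mu)"
    (is "_ = ?R")
proof (rule set_eqI)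
  fix T
  have ends: "\<exists>T'. T = T' @ [nu]" if "T \<in> std_tableaux n lam nu"
  proof -
    have "T \<noteq> []" using that by (auto simp: std_tableaux_def)
    moreover have "last T = nu"
      using that \<open>T \<noteq> []\<close> by (simp add: std_tableaux_def last_conv_nth)
    ultimately show ?thesis by (metis append_butlast_last_id)
  qed
  show "T \<in> std_tableaux n lam nu \<longleftrightarrow> T \<in> ?R"
  proof
    assume T: "T \<in> std_tableaux n lam nu"
    then obtain T' where "T = T' @ [nu]" using ends by blast
    with T snoc_in_std_tableaux_iff[OF assms, of T'] show "T \<in> ?R" by blast
  next
    assume "T \<in> ?R"
    then obtain T' where "T = T' @ [nu]" and "\<exists>mu. is_partition n mu \<and> mu \<le> lam \<and> nu \<le> mu \<and>
        weight n mu = Suc (weight n nu) \<and> T' \<in> std_tableaux n lam mu" by blast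
    then show "T \<in> std_tableaux n lam nu" by (simp only: snoc_in_std_tableaux_iff[OF assms])
  qed
qed

text \<open>Tableaux are grouped by their last entry but one, \<mu>; the groups are disjoint since a
  chain determines its end. The removed step has number |\<lambda>| - |\<nu>|, the same in every
  tableau, so its factor depends on \<mu> and \<nu> alone.\<close>

lemma sum_prod_std_tableaux_step:
  fixes h :: "nat \<Rightarrow> (nat \<Rightarrow> nat) \<Rightarrow> (nat \<Rightarrow> nat) \<Rightarrow> real"
  assumes "is_partition n nu" "Suc (weight n nu) \<le> weight n lam"
  defines "G \<equiv> \<lambda>mu. \<Sum>T\<in>std_tableaux n lam mu.
    \<Prod>i=1..weight n lam - weight n mu. h i (T ! (i - 1)) (T ! i)"
  shows "G nu = (\<Sum>mu | is_partition n mu \<and> mu \<le> lam \<and> nu \<le> mu \<and> weight n mu = Suc (weight n nu).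
    G mu * h (weight n lam - weight n nu) mu nu)"
proof -
  define M where "M = {mu. is_partition n mu \<and> mu \<le> lam \<and> nu \<le> mu \<and> weight n mu = Suc (weight n nu)}"
  define m where "m = weight n lam - Suc (weight n nu)"
  have m: "weight n lam - weight n nu = Suc m" using assms(2) by (simp add: m_def)
  have m': "weight n lam - weight n mu = m" if "mu \<in> M" for mu
    using that by (simp add: M_def m_def)
  have finM: "finite M"
    by (rule finite_subset[OF _ finite_partitions_below[of n lam]]) (auto simp: M_def)
  have last: "T ! m = mu" if "mu \<in> M" "T \<in> std_tableaux n lam mu" for mu T
    using that m'[OF that(1)] by (simp add: std_tableaux_def)
  have len: "length T = Suc m" if "mu \<in> M" "T \<in> std_tableaux n lam mu" for mu T
    using that m'[OF that(1)] by (simp add: std_tableaux_def)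
  have "G nu = (\<Sum>T\<in>(\<Union>mu\<in>M. (\<lambda>T. T @ [nu]) ` std_tableaux n lam mu).
      \<Prod>i=1..Suc m. h i (T ! (i - 1)) (T ! i))"
    unfolding G_def m std_tableaux_step[OF assms(1,2), folded M_def] ..
  also have "\<dots> = (\<Sum>mu\<in>M. \<Sum>T\<in>(\<lambda>T. T @ [nu]) ` std_tableaux n lam mu.
      \<Prod>i=1..Suc m. h i (T ! (i - 1)) (T ! i))"
  proof (rule sum.UNION_disjoint[OF finM])
    show "\<forall>mu\<in>M. finite ((\<lambda>T. T @ [nu]) ` std_tableaux n lam mu)"
      by (simp add: finite_std_tableaux)
    have "mu = mu'" if "mu \<in> M" "mu' \<in> M" "T \<in> std_tableaux n lam mu" "T \<in> std_tableaux n lam mu'"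
      for mu mu' T
      using last[OF that(1,3)] last[OF that(2,4)] by simp
    then show "\<forall>mu\<in>M. \<forall>mu'\<in>M. mu \<noteq> mu' \<longrightarrow>
        (\<lambda>T. T @ [nu]) ` std_tableaux n lam mu \<inter> (\<lambda>T. T @ [nu]) ` std_tableaux n lam mu' = {}"
      by auto
  qed
  also have "\<dots> = (\<Sum>mu\<in>M. G mu * h (Suc m) mu nu)"
  proof (intro sum.cong refl)
    fix mu assume mu: "mu \<in> M"
    have "(\<Prod>i=1..Suc m. h i ((T @ [nu]) ! (i - 1)) ((T @ [nu]) ! i))
        = (\<Prod>i=1..m. h i (T ! (i - 1)) (T ! i)) * h (Suc m) mu nu"
      if T: "T \<in> std_tableaux n lam mu" for T
    proof -
      have "(\<Prod>i=1..m. h i ((T @ [nu]) ! (i - 1)) ((T @ [nu]) ! i))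
          = (\<Prod>i=1..m. h i (T ! (i - 1)) (T ! i))"
        by (intro prod.cong refl) (use len[OF mu T] in \<open>auto simp: nth_append\<close>)
      then show ?thesis using len[OF mu T] last[OF mu T] by (simp add: nth_append)
    qed
    then show "(\<Sum>T\<in>(\<lambda>T. T @ [nu]) ` std_tableaux n lam mu.
        \<Prod>i=1..Suc m. h i (T ! (i - 1)) (T ! i)) = G mu * h (Suc m) mu nu"
      unfolding G_def m'[OF mu]
      by (subst sum.reindex) (simp_all add: sum_distrib_right inj_on_def)
  qed
  finally show ?thesis unfolding m M_def .
qed

section \<open>The Bessel polynomial\<close>

theorem proposition3p2:
  fixes n :: nat and a \<kappa> :: real and lam :: "nat \<Rightarrow> nat"
    and binom :: "(nat \<Rightarrow> nat) \<Rightarrow> (nat \<Rightarrow> nat) \<Rightarrow> real"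
  assumes "n \<ge> 1"
    and "is_partition n lam"
    and jack_well_defined: "\<And>mu. is_partition n mu \<Longrightarrow> mu \<le> lam \<Longrightarrow> \<exists>!P. is_jack n \<kappa> mu P"
    and jack_at_one_nonzero: "\<And>mu. is_partition n mu \<Longrightarrow> mu \<le> lam \<Longrightarrow> jack_at_one n \<kappa> mu \<noteq> 0"
    and binomials: "\<And>\<nu>. is_partition n \<nu> \<Longrightarrow> \<nu> \<le> lam \<Longrightarrow> gen_binomials n \<kappa> \<nu> (binom \<nu>)"
    and bessel_well_defined:
      "\<And>mu. is_partition n mu \<Longrightarrow> mu < lam \<Longrightarrow> eigval_e n a \<kappa> mu \<noteq> eigval_e n a \<kappa> lam"
  shows "bessel n a \<kappa> lam =
    (\<lambda>x. jack n \<kappa> lam x +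
      (\<Sum>mu | is_partition n mu \<and> mu < lam.
         (2 ^ (weight n lam - weight n mu) *
          (\<Sum>T\<in>std_tableaux n lam mu.
             \<Prod>i=1..weight n lam - weight n mu.
               jack_at_one n \<kappa> (T ! (i - 1)) / jack_at_one n \<kappa> (T ! i) *
               binom (T ! (i - 1)) (T ! i) *
               (1 / (a * real i + eigval_d n \<kappa> lam - eigval_d n \<kappa> (T ! i))))) *
         jack n \<kappa> mu x))"
proof -
  define F where "F = {mu. is_partition n mu \<and> mu \<le> lam}"
  define P where "P = jack n \<kappa>"
  define e where "e = eigval_e n a \<kappa>"
  define C where "C mu nu = jack_at_one n \<kappa> mu / jack_at_one n \<kappa> nu * binom mu nu" for mu nu
  define cov where "cov mu nu \<longleftrightarrow> nu \<le> mu \<and> weight n mu = Suc (weight n nu)" for mu nu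
  define h where "h i mu nu = C mu nu * (1 / (a * real i + eigval_d n \<kappa> lam - eigval_d n \<kappa> nu))"
    for i mu nu
  define G where "G mu = (\<Sum>T\<in>std_tableaux n lam mu.
      \<Prod>i=1..weight n lam - weight n mu. h i (T ! (i - 1)) (T ! i))" for mu
  define U where "U mu = 2 ^ (weight n lam - weight n mu) * G mu" for mu

  have finF: "finite F" unfolding F_def by (rule finite_partitions_below)
  have lam_F: "lam \<in> F" using assms(2) by (simp add: F_def)
  have F_less: "{mu. is_partition n mu \<and> mu < lam} = F - {lam}"
    by (auto simp: F_def less_le)
  have J: "is_jack n \<kappa> mu (jack n \<kappa> mu)" if "is_partition n mu" "mu \<le> lam" for mu
    using theI'[OF jack_well_defined[OF that]] unfolding jack_def .
  have PJ: "is_partition n mu \<and> is_jack n \<kappa> mu (P mu)" if "mu \<in> F" for mu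
    using J that by (auto simp: F_def P_def)
  have indep: "v mu = 0"
    if "\<And>x. inj_on x {1..n} \<Longrightarrow> (\<Sum>mu\<in>F. v mu * P mu x) = 0" "mu \<in> F" for v mu
    using finF PJ that by (rule jack_independent)
  have polyP: "polyfun n (P mu)" if "mu \<in> F" for mu
    using PJ[OF that] polyfun_jack by blast

  have DB_P: "op_DB n a \<kappa> (P mu) x =
      e mu * P mu x + 2 * (\<Sum>nu | nu \<in> F \<and> cov mu nu. C mu nu * P nu x)"
    if "mu \<in> F" "inj_on x {1..n}" for mu x
  proof -
    have mu: "is_partition n mu" "mu \<le> lam" using that by (auto simp: F_def)
    have "{nu. is_partition n nu \<and> nu \<le> mu \<and> weight n mu = Suc (weight n nu)}
        = {nu. nu \<in> F \<and> cov mu nu}"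
      using mu by (auto simp: F_def cov_def)
    moreover have "op_DB n a \<kappa> (jack n \<kappa> mu) x = eigval_e n a \<kappa> mu * jack n \<kappa> mu x +
      2 * (\<Sum>nu | is_partition n nu \<and> nu \<le> mu \<and> weight n mu = Suc (weight n nu).
        jack_at_one n \<kappa> mu / jack_at_one n \<kappa> nu * binom mu nu * jack n \<kappa> nu x)"
      by (rule op_DB_jack[OF mu(1) _ jack_at_one_nonzero[OF mu] binomials[OF mu] that(2)])
        (use mu J order_trans in blast)
    ultimately show ?thesis by (simp add: P_def e_def C_def)
  qed
  have DB_sum: "op_DB n a \<kappa> (\<lambda>x. \<Sum>mu\<in>F. u mu * P mu x) x =
      (\<Sum>nu\<in>F. (e nu * u nu + 2 * (\<Sum>mu | mu \<in> F \<and> cov mu nu. u mu * C mu nu)) * P nu x)"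
    if "inj_on x {1..n}" for u x
  proof -
    \<comment> \<open>The pairs are regrouped by the smaller diagram: P_\<nu> receives a
      contribution from each \<mu> with one box more.\<close>
    have "(\<Sum>mu\<in>F. \<Sum>nu | nu \<in> F \<and> cov mu nu. 2 * (u mu * C mu nu * P nu x))
        = (\<Sum>nu\<in>F. \<Sum>mu | mu \<in> F \<and> cov mu nu. 2 * (u mu * C mu nu * P nu x))"
      by (rule sum.swap_restrict) (rule finF)+
    then show ?thesis
      using that by (simp add: op_DB_sum[OF polyP] DB_P distrib_left distrib_right sum.distrib
          sum_distrib_left sum_distrib_right mult_ac)
  qed

  \<comment> \<open>Stated for arbitrary c and u and in both directions: one direction shows that
    the tableau sums give an eigenfunction, the other that any candidate obeys the
    recursion.\<close>
  have eigen_iff: "(\<forall>x. inj_on x {1..n} \<longrightarrow>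
        op_DB n a \<kappa> (\<lambda>x. \<Sum>mu\<in>F. u mu * P mu x) x = c * (\<Sum>mu\<in>F. u mu * P mu x)) \<longleftrightarrow>
      (\<forall>nu\<in>F. (c - e nu) * u nu = 2 * (\<Sum>mu | mu \<in> F \<and> cov mu nu. u mu * C mu nu))"
    (is "?lhs \<longleftrightarrow> ?rhs") for u c
  proof
    define v where
      "v nu = e nu * u nu + 2 * (\<Sum>mu | mu \<in> F \<and> cov mu nu. u mu * C mu nu) - c * u nu" for nu
    assume L: ?lhs
    have "(\<Sum>nu\<in>F. v nu * P nu x) = 0" if "inj_on x {1..n}" for x
    proof -
      have "(\<Sum>nu\<in>F. v nu * P nu x) =
          op_DB n a \<kappa> (\<lambda>x. \<Sum>mu\<in>F. u mu * P mu x) x - c * (\<Sum>mu\<in>F. u mu * P mu x)"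
        unfolding DB_sum[OF that] v_def sum_distrib_left sum_subtractf[symmetric]
        by (simp add: left_diff_distrib mult.assoc)
      then show ?thesis using L that by simp
    qed
    then have "\<forall>nu\<in>F. v nu = 0" using indep by blast
    then show ?rhs by (simp add: v_def algebra_simps)
  next
    assume R: ?rhs
    have "e nu * u nu + 2 * (\<Sum>mu | mu \<in> F \<and> cov mu nu. u mu * C mu nu) = c * u nu"
      if "nu \<in> F" for nu
      using R that by (simp add: algebra_simps)
    then show ?lhs by (simp add: DB_sum sum_distrib_left mult.assoc)
  qed
  \<comment> \<open>No diagram inside \<open>lam\<close> has one box more than \<open>lam\<close>.
    At \<open>lam\<close> the right side of the system is therefore 0, which forces c = e_\<lambda>
    when the leading coefficient is 1.\<close>
  have no_cover: "{mu. mu \<in> F \<and> cov mu lam} = {}"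
    using weight_mono by (fastforce simp: F_def cov_def)

  have U_lam: "U lam = 1"
    by (simp add: U_def G_def std_tableaux_self[OF assms(2)])
  have U_rec: "(e lam - e nu) * U nu = 2 * (\<Sum>mu | mu \<in> F \<and> cov mu nu. U mu * C mu nu)"
    if "nu \<in> F" for nu
  proof (cases "nu = lam")
    case True
    then show ?thesis by (simp add: no_cover)
  next
    case False
    define r where "r = weight n lam - weight n nu"
    have nu: "is_partition n nu" "nu < lam" using that False by (auto simp: F_def less_le)
    have w: "weight n nu < weight n lam" by (rule weight_less[OF assms(2) nu(2)])
    \<comment> \<open>The difference of eigenvalues is exactly the denominator of the last tableau
      step: the terms a|\<lambda>| and a|\<nu>| differ by a times the step number r.\<close>
    have "e lam - e nu = a * real r + eigval_d n \<kappa> lam - eigval_d n \<kappa> nu"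
      using w by (simp add: e_def eigval_e_def r_def of_nat_diff algebra_simps)
    moreover have ne: "e lam - e nu \<noteq> 0" using bessel_well_defined[OF nu] by (simp add: e_def)
    ultimately have h: "(e lam - e nu) * h r mu nu = C mu nu" for mu
      by (simp add: h_def)
    have M: "{mu. is_partition n mu \<and> mu \<le> lam \<and> nu \<le> mu \<and> weight n mu = Suc (weight n nu)}
        = {mu. mu \<in> F \<and> cov mu nu}"
      by (auto simp: F_def cov_def)
    have G_step: "G nu = (\<Sum>mu | mu \<in> F \<and> cov mu nu. G mu * h r mu nu)"
      using sum_prod_std_tableaux_step[OF nu(1) Suc_leI[OF w], of h] unfolding G_def r_def M .
    have "(e lam - e nu) * U nu = (\<Sum>mu | mu \<in> F \<and> cov mu nu. 2 ^ r * (G mu * C mu nu))"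
      unfolding U_def G_step r_def[symmetric] h[symmetric] by (simp add: sum_distrib_left mult_ac)
    \<comment> \<open>One of the r factors 2 is the coefficient of E_0 in D^B; the other r - 1
      belong to \<open>U mu\<close>.\<close>
    also have "\<dots> = (\<Sum>mu | mu \<in> F \<and> cov mu nu. 2 * (U mu * C mu nu))"
    proof (intro sum.cong refl)
      fix mu assume "mu \<in> {mu. mu \<in> F \<and> cov mu nu}"
      then have "r = Suc (weight n lam - weight n mu)"
        using w by (simp add: cov_def r_def)
      then show "2 ^ r * (G mu * C mu nu) = 2 * (U mu * C mu nu)" by (simp add: U_def)
    qed
    finally show ?thesis by (simp add: sum_distrib_left)
  qed
  have split: "(\<Sum>mu\<in>F. u mu * P mu x) = u lam * P lam x + (\<Sum>mu\<in>F - {lam}. u mu * P mu x)" for u x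
    by (rule sum.remove[OF finF lam_F])

  have bessel: "is_bessel n a \<kappa> lam (\<lambda>x. \<Sum>mu\<in>F. U mu * P mu x)"
  proof -
    \<comment> \<open>If the sum vanished everywhere, independence would give
      \<open>U lam = 0\<close>.\<close>
    have "\<exists>x. (\<Sum>mu\<in>F. U mu * P mu x) \<noteq> 0"
      using indep[OF _ lam_F, of U] U_lam by fastforce
    moreover have "\<forall>x. inj_on x {1..n} \<longrightarrow>
        op_DB n a \<kappa> (\<lambda>x. \<Sum>mu\<in>F. U mu * P mu x) x = e lam * (\<Sum>mu\<in>F. U mu * P mu x)"
      using eigen_iff U_rec by blast
    ultimately show ?thesis
      unfolding is_bessel_def eigenfunction_def F_less P_def[symmetric]
      by (auto simp: split U_lam intro: exI[of _ U])
  qed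
  have unique: "Y = (\<lambda>x. \<Sum>mu\<in>F. U mu * P mu x)" if "is_bessel n a \<kappa> lam Y" for Y
  proof -
    have "\<exists>u. Y = (\<lambda>x. P lam x + (\<Sum>mu\<in>F - {lam}. u mu * P mu x))"
      using that unfolding is_bessel_def F_less P_def[symmetric] by (rule conjunct1)
    then obtain u0 where u0: "Y = (\<lambda>x. P lam x + (\<Sum>mu\<in>F - {lam}. u0 mu * P mu x))" ..
    define u where "u = u0(lam := 1)"
    have Y: "Y = (\<lambda>x. \<Sum>mu\<in>F. u mu * P mu x)"
      unfolding u0 split by (auto simp: u_def intro!: sum.cong)
    have "eigenfunction n (op_DB n a \<kappa>) Y" using that unfolding is_bessel_def by (rule conjunct2)
    then obtain c where "\<forall>x. inj_on x {1..n} \<longrightarrow> op_DB n a \<kappa> Y x = c * Y x"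
      unfolding eigenfunction_def by blast
    then have rec: "(c - e nu) * u nu = 2 * (\<Sum>mu | mu \<in> F \<and> cov mu nu. u mu * C mu nu)"
      if "nu \<in> F" for nu
      using eigen_iff[of u c] that unfolding Y by blast
    have c: "c = e lam" using rec[OF lam_F] by (simp add: no_cover u_def)
    have "u nu = U nu" if "nu \<in> F" for nu
      using that
    \<comment> \<open>Induction on the number of boxes missing from \<open>lam\<close>: the \<mu> in
      the recursion for \<nu> miss one box fewer, and e_\<lambda> - e_\<nu> can be
      cancelled.\<close>
    proof (induction "weight n lam - weight n nu" arbitrary: nu rule: less_induct)
      case less
      show ?case
      proof (cases "nu = lam")
        case True
        then show ?thesis by (simp add: u_def U_lam)
      next
        case False
        then have nu: "is_partition n nu" "nu < lam" using less.prems by (auto simp: F_def less_le)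
        have w: "weight n nu < weight n lam" by (rule weight_less[OF assms(2) nu(2)])
        have "u mu = U mu" if "mu \<in> F" "cov mu nu" for mu
          using that w by (intro less.hyps) (auto simp: cov_def)
        then have "(\<Sum>mu | mu \<in> F \<and> cov mu nu. u mu * C mu nu)
            = (\<Sum>mu | mu \<in> F \<and> cov mu nu. U mu * C mu nu)"
          by (intro sum.cong refl) simp
        then have "(e lam - e nu) * u nu = (e lam - e nu) * U nu"
          using rec[OF less.prems] U_rec[OF less.prems] c by simp
        then show ?thesis using bessel_well_defined[OF nu] by (simp add: e_def)
      qed
    qed
    then show ?thesis unfolding Y by (auto intro!: sum.cong)
  qed
  have "bessel n a \<kappa> lam = (\<lambda>x. \<Sum>mu\<in>F. U mu * P mu x)"
    unfolding bessel_def using bessel unique by (rule the_equality)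
  then show ?thesis
    unfolding split U_lam F_less unfolding U_def G_def h_def C_def P_def by simp
qed

end
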